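(* There exists a constant $C \in (0,1)$ such that for every $y \in H^1(\mathbb{R}) \cap L^2_1(\mathbb{R})$ satisfying the constraints $$\langle u_0, y \rangle_{L^2} = \langle \partial_x^{-1} u_0, y \rangle_{L^2} = 0,$$ it is true that $$C \| y \|^2_{H^1 \cap L^2_1} \leq E_c(y) \leq \| y \|^2_{H^1 \cap L^2_1},$$ where $E_c(y) = \langle L y, y \rangle_{L^2}$.
   Context: All functions are real-valued on $\mathbb{R}$. $L^2_1(\mathbb{R})$ is the space of square integrable functions with the weight $(1+x^2)^{1/2}$, i.e. $\int_{\mathbb R} (1+x^2)u^2\,dx<\infty$. $u_0(x) = (2\pi)^{-1/4} e^{-x^2/4}$ (an $L^2$-normalized Gaussian) and $(\partial_x^{-1} u_0)(x) := \int_{-\infty}^x u_0(x')\,dx'$. $L = -\partial_x^2 + \frac14(x^2-6)$ is the Schrödinger operator on $L^2(\mathbb{R})$ with domain $H^2(\mathbb{R}) \cap L^2_2(\mathbb{R})$; its quadratic form on $H^1(\mathbb{R})\cap L^2_1(\mathbb{R})$ is $$E_c(y) = \langle Ly,y\rangle_{L^2} = \int_{\mathbb{R}} \left[ y_x^2 + \tfrac14 x^2 y^2 - \tfrac32 y^2 \right] dx .$$ The norm used is $$\| u \|_{H^1 \cap L^2_1}^2 := \int_{\mathbb{R}} \left[ u_x^2 + \tfrac{1}{4} x^2 u^2 + \tfrac{1}{2} u^2 \right] dx.$$ *)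

theory Defs
  imports "HOL-Analysis.Analysis"
begin

text \<open>
  Elements of the function spaces are represented by Lebesgue measurable functions
  (not by classes modulo almost everywhere equality).
\<close>

definition L2 :: "(real \<Rightarrow> real) set" where
  "L2 = {u \<in> borel_measurable lebesgue. integrable lebesgue (\<lambda>x. (u x)\<^sup>2)}"

definition L2_1 :: "(real \<Rightarrow> real) set" where
  "L2_1 = {u \<in> borel_measurable lebesgue. integrable lebesgue (\<lambda>x. (1 + x\<^sup>2) * (u x)\<^sup>2)}"

definition L2_inner :: "(real \<Rightarrow> real) \<Rightarrow> (real \<Rightarrow> real) \<Rightarrow> real" where
  "L2_inner u v = (LINT x|lebesgue. u x * v x)"

definition test_functions :: "(real \<Rightarrow> real) set" where
  "test_functions = {\<phi>. (\<forall>n x. (deriv ^^ n) \<phi> differentiable (at x)) \<and>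
                         compact (closure {x. \<phi> x \<noteq> 0})}"

definition has_weak_deriv :: "(real \<Rightarrow> real) \<Rightarrow> (real \<Rightarrow> real) \<Rightarrow> bool" where
  "has_weak_deriv u g \<longleftrightarrow>
     (\<forall>\<phi>\<in>test_functions. (LINT x|lebesgue. u x * deriv \<phi> x) = - (LINT x|lebesgue. g x * \<phi> x))"

definition H1 :: "(real \<Rightarrow> real) set" where
  "H1 = {u \<in> L2. \<exists>g\<in>L2. has_weak_deriv u g}"

text \<open>
  For \<open>u\<close> in \<open>H1\<close> the square integrable weak derivative is unique up to a null set,
  so integrals of expressions in it do not depend on the choice made here.
\<close>

definition weak_deriv :: "(real \<Rightarrow> real) \<Rightarrow> real \<Rightarrow> real" where
  "weak_deriv u = (SOME g. g \<in> L2 \<and> has_weak_deriv u g)"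

definition u0 :: "real \<Rightarrow> real" where
  "u0 x = (2 * pi) powr (- 1 / 4) * exp (- x\<^sup>2 / 4)"

definition antideriv :: "(real \<Rightarrow> real) \<Rightarrow> real \<Rightarrow> real" where
  "antideriv f x = (LINT t:{..x}|lebesgue. f t)"

definition H1_L2_1_norm :: "(real \<Rightarrow> real) \<Rightarrow> real" where
  "H1_L2_1_norm u = sqrt (LINT x|lebesgue. (weak_deriv u x)\<^sup>2 + 1/4 * x\<^sup>2 * (u x)\<^sup>2 + 1/2 * (u x)\<^sup>2)"

text \<open>
  The quadratic form \<open>\<langle>L y, y\<rangle>\<close> of \<open>L = - d\<^sup>2/dx\<^sup>2 + (x\<^sup>2 - 6)/4\<close> on its form domain
  \<open>H1 \<inter> L2_1\<close>, where \<open>L y\<close> itself need not be a square integrable function.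
\<close>

definition E_c :: "(real \<Rightarrow> real) \<Rightarrow> real" where
  "E_c y = (LINT x|lebesgue. (weak_deriv y x)\<^sup>2 + 1/4 * x\<^sup>2 * (y x)\<^sup>2 - 3/2 * (y x)\<^sup>2)"

end

theory Submission
  imports Defs "HOL-Probability.Sinc_Integral" "HOL-Computational_Algebra.Polynomial"
begin

text \<open>
  The spectral gap of the harmonic oscillator is obtained without eigenfunction expansions. Write
  \<open>F(y)\<close> for the quadratic form of \<open>L\<close> and \<open>g\<^sub>0 = exp (- x\<^sup>2 / 4)\<close>, so that \<open>L g\<^sub>0 = - g\<^sub>0\<close> and
  \<open>L (x g\<^sub>0) = 0\<close>. If \<open>W\<close> vanishes at two points \<open>\<plusminus> a\<close> with \<open>a\<close> slightly larger than \<open>1\<close>, Jacobi's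
  trick on the three intervals cut out by \<open>\<plusminus> a\<close> gives \<open>F(W) \<ge> \<parallel>W\<parallel>\<^sup>2 / 10\<close>. For \<open>y\<close> orthogonal
  to \<open>g\<^sub>0\<close>, choose \<open>\<alpha>, \<beta>\<close> such that \<open>W = y + \<alpha> g\<^sub>0 + \<beta> x g\<^sub>0\<close> vanishes at \<open>\<plusminus> a\<close>. Then
  \<open>F(W) = F(y) - \<alpha>\<^sup>2 \<parallel>g\<^sub>0\<parallel>\<^sup>2\<close>, and \<open>y + \<beta> x g\<^sub>0\<close> has the same energy as \<open>y\<close> and is controlled by it.
  The second constraint bounds \<open>\<beta>\<close>, since \<open>\<partial>\<^sup>-\<^sup>1 u\<^sub>0\<close> is not orthogonal to \<open>x g\<^sub>0\<close>.
  Pointwise values of \<open>y\<close> make sense because the du Bois-Reymond lemma supplies an absolutely continuous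
  representative.
\<close>

section \<open>Absolutely continuous functions\<close>

text \<open>Orthogonality to \<open>antideriv u0\<close> is not orthogonality to an eigenfunction:
  this function tends to a positive constant at infinity and is not even square integrable. It
  excludes the kernel direction of \<open>L\<close> only through a nonzero pairing, and the weight
  of \<open>L2_1\<close> is what keeps that pairing bounded. The natural nodes would be the zeros
  +-1 of the second Hermite function, which has eigenvalue 5/2 for \<open>- d^2/dx^2 + x^2/4\<close>
  and is of one sign on each of the three intervals. Its logarithmic derivative, however, has poles
  exactly there. Moving the nodes slightly outwards removes the poles from the outer intervals,
  while the middle interval has room for a cruder positive function: it lowers 5/2 to 8/5, still
  above the value 3/2 that belongs to the kernel. The negative direction is harmless: adding a
  multiple of the Gaussian lowers the energy and raises the \<open>L2\<close> norm of a function
  orthogonal to it, so a lower bound for \<open>W\<close> gives an even better one for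
  \<open>W\<close> without its Gaussian component.\<close>

text \<open>Local absolute continuity of \<open>F\<close> with almost everywhere derivative \<open>f\<close>.\<close>

definition primitive_on :: "real set \<Rightarrow> (real \<Rightarrow> real) \<Rightarrow> (real \<Rightarrow> real) \<Rightarrow> bool" where
  "primitive_on S F f \<longleftrightarrow>
     (\<forall>a b. a \<le> b \<and> {a..b} \<subseteq> S \<longrightarrow>
        f absolutely_integrable_on {a..b} \<and> (f has_integral (F b - F a)) {a..b})"

lemma primitive_onI:
  assumes "\<And>a b. a \<le> b \<Longrightarrow> {a..b} \<subseteq> S \<Longrightarrow> f absolutely_integrable_on {a..b}"
    and "\<And>a b. a \<le> b \<Longrightarrow> {a..b} \<subseteq> S \<Longrightarrow> (f has_integral (F b - F a)) {a..b}"
  shows "primitive_on S F f"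
  using assms unfolding primitive_on_def by blast

lemma primitive_onD:
  assumes "primitive_on S F f" "a \<le> b" "{a..b} \<subseteq> S"
  shows "f absolutely_integrable_on {a..b}" "(f has_integral (F b - F a)) {a..b}"
  using assms unfolding primitive_on_def by blast+

lemma primitive_on_subset: "primitive_on S F f \<Longrightarrow> T \<subseteq> S \<Longrightarrow> primitive_on T F f"
  unfolding primitive_on_def by blast

lemma primitive_on_add:
  assumes "primitive_on S F f" "primitive_on S G g"
  shows "primitive_on S (\<lambda>x. F x + G x) (\<lambda>x. f x + g x)"
proof (rule primitive_onI)
  fix a b :: real assume ab: "a \<le> b" "{a..b} \<subseteq> S"
  note 1 = primitive_onD[OF assms(1) ab] and 2 = primitive_onD[OF assms(2) ab]
  show "(\<lambda>x. f x + g x) absolutely_integrable_on {a..b}"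
    using 1 2 by (simp add: set_integral_add(1))
  show "((\<lambda>x. f x + g x) has_integral F b + G b - (F a + G a)) {a..b}"
    using has_integral_add[OF 1(2) 2(2)] by (simp add: algebra_simps)
qed

lemma primitive_on_cmult:
  assumes "primitive_on S F f"
  shows "primitive_on S (\<lambda>x. c * F x) (\<lambda>x. c * f x)"
proof (rule primitive_onI)
  fix a b :: real assume ab: "a \<le> b" "{a..b} \<subseteq> S"
  note 1 = primitive_onD[OF assms(1) ab]
  show "(\<lambda>x. c * f x) absolutely_integrable_on {a..b}"
    using 1 by simp
  show "((\<lambda>x. c * f x) has_integral c * F b - c * F a) {a..b}"
    using has_integral_mult_right[OF 1(2), of c] by (simp add: algebra_simps)
qed

lemma primitive_on_deriv:
  assumes "\<And>x. x \<in> S \<Longrightarrow> (F has_real_derivative f x) (at x)" "continuous_on S f"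
  shows "primitive_on S F f"
proof (rule primitive_onI)
  fix a b :: real assume ab: "a \<le> b" "{a..b} \<subseteq> S"
  show "f absolutely_integrable_on {a..b}"
    using assms(2) ab by (intro absolutely_integrable_continuous_real) (blast intro: continuous_on_subset)
  show "(f has_integral F b - F a) {a..b}"
  proof (rule fundamental_theorem_of_calculus[OF ab(1)])
    fix x assume "x \<in> {a..b}"
    with assms(1) ab have "(F has_real_derivative f x) (at x)" by blast
    then show "(F has_vector_derivative f x) (at x within {a..b})"
      by (simp add: has_real_derivative_iff_has_vector_derivative has_vector_derivative_at_within)
  qed
qed

lemma primitive_on_reflect:
  assumes "primitive_on S F f"
  shows "primitive_on (uminus ` S) (\<lambda>x. F (- x)) (\<lambda>x. - f (- x))"
proof (rule primitive_onI)
  fix a b :: real assume ab: "a \<le> b" "{a..b} \<subseteq> uminus ` S"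
  have ba: "- b \<le> - a" "{-b..-a} \<subseteq> S"
  proof -
    show "{-b..-a} \<subseteq> S"
    proof
      fix x assume "x \<in> {-b..-a}"
      then have "- x \<in> {a..b}" by auto
      then have "- x \<in> uminus ` S" using ab by blast
      then show "x \<in> S" by auto
    qed
  qed (use ab in auto)
  note 1 = primitive_onD[OF assms(1) ba]
  have "(\<lambda>x. f (- x)) absolutely_integrable_on {a..b}"
    using 1(1) absolutely_integrable_reflect_real[where f = f and a = "- b" and b = "- a"] by simp
  then show "(\<lambda>x. - f (- x)) absolutely_integrable_on {a..b}"
    by (simp add: absolutely_integrable_on_def integrable_neg_iff)
  have "((\<lambda>x. f (- x)) has_integral F (- a) - F (- b)) {a..b}"
    using 1(2) has_integral_reflect_real[where f = f and a = "- b" and b = "- a"] by simp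
  from has_integral_neg[OF this]
  show "((\<lambda>x. - f (- x)) has_integral F (- b) - F (- a)) {a..b}"
    by simp
qed

lemma primitive_on_continuous:
  assumes "primitive_on S F f" "a \<le> b" "{a..b} \<subseteq> S"
  shows "continuous_on {a..b} F"
proof -
  note 1 = primitive_onD[OF assms]
  have "continuous_on {a..b} (\<lambda>x. integral {a..x} f)"
    using 1 by (intro indefinite_integral_continuous_1) auto
  then have c: "continuous_on {a..b} (\<lambda>x. F a + integral {a..x} f)"
    by (intro continuous_intros)
  have "F x = F a + integral {a..x} f" if "x \<in> {a..b}" for x
  proof -
    have "(f has_integral F x - F a) {a..x}"
      using that assms by (intro primitive_onD(2)[OF assms(1)]) auto
    then show ?thesis by (simp add: integral_unique)
  qed
  with c show ?thesis
    using continuous_on_cong[of "{a..b}" "{a..b}" F "\<lambda>x. F a + integral {a..x} f"] by blast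
qed

section \<open>Integration by parts for absolutely continuous functions\<close>

lemma integral_mult_split:
  fixes p q :: "real \<Rightarrow> real"
  assumes p: "integrable lborel p" and q: "integrable lborel q"
  shows "(LINT x|lborel. p x) * (LINT x|lborel. q x) =
     (LINT s|lborel. p s * (LINT t|lborel. indicator {..s} t * q t)) +
     (LINT t|lborel. q t * (LINT s|lborel. indicator {..<t} s * p s))"
proof -
  have [measurable]: "p \<in> borel_measurable borel" "q \<in> borel_measurable borel"
    using p q by (auto dest: borel_measurable_integrable)
  have pq: "integrable (lborel \<Otimes>\<^sub>M lborel) (\<lambda>(s, t). p s * q t)"
    by (rule lborel_pair.Fubini_integrable) (use p q in \<open>auto simp: abs_mult\<close>)
  have 1: "integrable (lborel \<Otimes>\<^sub>M lborel) (\<lambda>(s, t). p s * (indicator {..s} t * q t))"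
    by (rule Bochner_Integration.integrable_bound[OF pq])
      (auto simp: abs_mult indicator_def split: prod.split)
  have 2: "integrable (lborel \<Otimes>\<^sub>M lborel) (\<lambda>(s, t). q t * (indicator {..<t} s * p s))"
    by (rule Bochner_Integration.integrable_bound[OF pq])
      (auto simp: abs_mult indicator_def split: prod.split)
  have "(LINT x|lborel. p x) * (LINT x|lborel. q x) = (LINT s|lborel. LINT t|lborel. p s * q t)"
    by simp
  also have "\<dots> = (LINT z|(lborel \<Otimes>\<^sub>M lborel). (case z of (s, t) \<Rightarrow> p s * q t))"
    using lborel_pair.integral_fst[OF pq] by simp
  \<comment> \<open>The plane is cut into the triangles \<open>t \<le> s\<close> and
    \<open>s < t\<close>; strictness in one of them counts the diagonal once, so the identity holds
    pointwise.\<close>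
  also have "\<dots> = (LINT z|(lborel \<Otimes>\<^sub>M lborel). (case z of (s, t) \<Rightarrow> p s * (indicator {..s} t * q t))
      + (case z of (s, t) \<Rightarrow> q t * (indicator {..<t} s * p s)))"
    by (intro Bochner_Integration.integral_cong) (auto simp: indicator_def)
  also have "\<dots> = (LINT z|(lborel \<Otimes>\<^sub>M lborel). (case z of (s, t) \<Rightarrow> p s * (indicator {..s} t * q t)))
      + (LINT z|(lborel \<Otimes>\<^sub>M lborel). (case z of (s, t) \<Rightarrow> q t * (indicator {..<t} s * p s)))"
    using 1 2 by (rule Bochner_Integration.integral_add)
  also have "(LINT z|(lborel \<Otimes>\<^sub>M lborel). (case z of (s, t) \<Rightarrow> p s * (indicator {..s} t * q t)))
     = (LINT s|lborel. LINT t|lborel. p s * (indicator {..s} t * q t))"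
    using lborel_pair.integral_fst[OF 1] by simp
  also have "(LINT z|(lborel \<Otimes>\<^sub>M lborel). (case z of (s, t) \<Rightarrow> q t * (indicator {..<t} s * p s)))
     = (LINT t|lborel. LINT s|lborel. q t * (indicator {..<t} s * p s))"
    using lborel_pair.integral_snd[OF 2] by simp
  finally show ?thesis by simp
qed

text \<open>Fubini is applied to the product of two copies of \<open>lborel\<close>, so a Lebesgue
  measurable integrand is first traded for a Borel function. The latter agrees with the integrand
  cut off to \<open>S\<close>, hence vanishes almost everywhere outside \<open>S\<close>.\<close>

lemma absolutely_integrable_borel_version:
  fixes f :: "real \<Rightarrow> real"
  assumes "f absolutely_integrable_on S"
  obtains f0 where "integrable lborel f0" "AE x in lborel. indicator S x * f x = f0 x"
proof -
  have i: "integrable lebesgue (\<lambda>x. indicator S x * f x)"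
    using assms by (simp add: set_integrable_def)
  then obtain f0 where f0: "f0 \<in> borel_measurable lborel" "AE x in lborel. indicator S x * f x = f0 x"
    using completion_ex_borel_measurable_real borel_measurable_integrable by blast
  have "integrable lebesgue f0"
    by (rule integrable_cong_AE_imp[OF i]) (use f0 AE_completion in \<open>auto simp: measurable_completion\<close>)
  then have "integrable lborel f0"
    using f0(1) integrable_completion by blast
  with f0(2) show ?thesis using that by blast
qed

lemma integral_borel_version:
  fixes f f0 :: "real \<Rightarrow> real"
  assumes "AE x in lborel. indicator S x * f x = f0 x" "integrable lborel f0"
    and I: "(f has_integral I) T" and T: "T \<subseteq> S" "T \<in> sets borel" and f: "f absolutely_integrable_on T"
  shows "(LINT x|lborel. indicator T x * f0 x) = I"
proof -
  have "(LINT x|lborel. indicator T x * f0 x) = (LINT x|lebesgue. indicator T x * f0 x)"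
    using assms(2) T by (intro integral_completion[symmetric]) (auto dest: borel_measurable_integrable)
  also have "\<dots> = (LINT x|lebesgue. indicator T x * f x)"
  proof (rule integral_cong_AE)
    show "(\<lambda>x. indicator T x * f0 x) \<in> borel_measurable lebesgue"
      using assms(2) T by (intro measurable_completion) (auto dest: borel_measurable_integrable)
    show "(\<lambda>x. indicator T x * f x) \<in> borel_measurable lebesgue"
      using f by (auto simp: set_integrable_def dest: borel_measurable_integrable)
    show "AE x in lebesgue. indicator T x * f0 x = indicator T x * f x"
      using AE_completion[OF assms(1)] by eventually_elim (use T in \<open>auto simp: indicator_def split: if_splits\<close>)
  qed
  also have "\<dots> = I"
    using has_integral_unique[OF has_integral_set_lebesgue[OF f] I] by (simp add: set_lebesgue_integral_def)
  finally show ?thesis .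
qed

text \<open>The factors may fail to be differentiable on a null set, so a pointwise product rule
  does not suffice. Instead \<open>(P b - P a) * (Q b - Q a)\<close> is the double integral of
  \<open>p s * q t\<close> over a square; cut along the diagonal, it leaves inner integrals that are
  increments of \<open>Q\<close> and \<open>P\<close>.\<close>

lemma primitive_on_mult:
  assumes P: "primitive_on S P p" and Q: "primitive_on S Q q"
  shows "primitive_on S (\<lambda>x. P x * Q x) (\<lambda>x. p x * Q x + P x * q x)"
proof (rule primitive_onI)
  fix a b :: real assume ab: "a \<le> b" "{a..b} \<subseteq> S"
  note 1 = primitive_onD[OF P ab] and 2 = primitive_onD[OF Q ab]
  have ai: "(\<lambda>x. G x * f x) absolutely_integrable_on {a..b}"
    if "f absolutely_integrable_on {a..b}" "continuous_on {a..b} G" for f G :: "real \<Rightarrow> real"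
    by (rule absolutely_integrable_bounded_measurable_product_real)
      (use that in \<open>auto intro!: continuous_imp_measurable_on_sets_lebesgue compact_imp_bounded compact_continuous_image\<close>)
  note cP = primitive_on_continuous[OF P ab] and cQ = primitive_on_continuous[OF Q ab]
  note pQ = ai[OF 1(1) cQ] and Pq = ai[OF 2(1) cP]
  show "(\<lambda>x. p x * Q x + P x * q x) absolutely_integrable_on {a..b}"
    using pQ Pq by (simp add: mult.commute set_integral_add(1))
  obtain p0 where p0: "integrable lborel p0" "AE x in lborel. indicator {a..b} x * p x = p0 x"
    using absolutely_integrable_borel_version[OF 1(1)] .
  obtain q0 where q0: "integrable lborel q0" "AE x in lborel. indicator {a..b} x * q x = q0 x"
    using absolutely_integrable_borel_version[OF 2(1)] .
  have [measurable]: "p0 \<in> borel_measurable borel" "q0 \<in> borel_measurable borel"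
    using p0 q0 by (auto dest: borel_measurable_integrable)
  \<comment> \<open>Since \<open>f0\<close> vanishes almost everywhere outside
    \<open>{a..b}\<close>, the half-lines produced by the diagonal cut become intervals starting at
    \<open>a\<close>.\<close>
  have ind: "(LINT x|lborel. indicator A x * f0 x) = (LINT x|lborel. indicator (A \<inter> {a..b}) x * f0 x)"
    if "AE x in lborel. indicator {a..b} x * f x = f0 x" "A \<in> sets borel" "f0 \<in> borel_measurable borel"
    for f f0 :: "real \<Rightarrow> real" and A
    by (rule integral_cong_AE) (use that in \<open>auto elim!: eventually_mono simp: indicator_def split: if_splits\<close>)
  have Qs: "(LINT t|lborel. indicator {..s} t * q0 t) = Q s - Q a" if "s \<in> {a..b}" for s
  proof -
    have *: "{a..s} \<subseteq> S" "a \<le> s" "{a..s} \<subseteq> {a..b}" using that ab by auto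
    have **: "{..s} \<inter> {a..b} = {a..s}" using that by auto
    have "(LINT t|lborel. indicator {..s} t * q0 t) = (LINT t|lborel. indicator {a..s} t * q0 t)"
      using ind[OF q0(2), of "{..s}"] unfolding ** by simp
    also have "\<dots> = Q s - Q a"
      by (rule integral_borel_version[OF q0(2,1) primitive_onD(2)[OF Q]]) (use * primitive_onD(1)[OF Q] in auto)
    finally show ?thesis .
  qed
  have Pt: "(LINT t|lborel. indicator {..<s} t * p0 t) = P s - P a" if "s \<in> {a..b}" for s
  proof -
    have *: "{a..s} \<subseteq> S" "a \<le> s" "{a..s} \<subseteq> {a..b}" using that ab by auto
    have **: "{..s} \<inter> {a..b} = {a..s}" using that by auto
    have "(LINT t|lborel. indicator {..<s} t * p0 t) = (LINT t|lborel. indicator {..s} t * p0 t)"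
      by (rule integral_cong_AE) (use AE_lborel_singleton[of s] in \<open>auto elim!: eventually_mono simp: indicator_def split: if_splits\<close>)
    also have "\<dots> = (LINT t|lborel. indicator {a..s} t * p0 t)"
      using ind[OF p0(2), of "{..s}"] unfolding ** by simp
    also have "\<dots> = P s - P a"
      by (rule integral_borel_version[OF p0(2,1) primitive_onD(2)[OF P]]) (use * primitive_onD(1)[OF P] in auto)
    finally show ?thesis .
  qed
  have whole: "(LINT x|lborel. f0 x) = (LINT x|lborel. indicator {a..b} x * f0 x)"
    if "AE x in lborel. indicator {a..b} x * f x = f0 x" "f0 \<in> borel_measurable borel" for f f0 :: "real \<Rightarrow> real"
    using ind[OF that(1), of UNIV] that(2) by simp
  have p0I: "(LINT x|lborel. p0 x) = P b - P a"
    using integral_borel_version[OF p0(2,1) 1(2)] 1(1) whole[OF p0(2)] by simp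
  have q0I: "(LINT x|lborel. q0 x) = Q b - Q a"
    using integral_borel_version[OF q0(2,1) 2(2)] 2(1) whole[OF q0(2)] by simp
  \<comment> \<open>Return from the Borel version to \<open>f\<close>: outside \<open>{a..b}\<close>
    the values of \<open>G\<close> are irrelevant because \<open>f0\<close> is zero there almost
    everywhere.\<close>
  have cut: "(LINT s|lborel. f0 s * G s) = integral {a..b} (\<lambda>s. f s * (F s - F a))"
    if f0: "AE x in lborel. indicator {a..b} x * f x = f0 x" "f0 \<in> borel_measurable borel"
      and G: "\<And>s. s \<in> {a..b} \<Longrightarrow> G s = F s - F a" "G \<in> borel_measurable borel"
      and F: "continuous_on {a..b} F" and f: "f absolutely_integrable_on {a..b}"
    for f0 f G F :: "real \<Rightarrow> real"
  proof -
    have "continuous_on {a..b} (\<lambda>s. F s - F a)"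
      using F by (intro continuous_intros)
    from ai[OF f this] have i: "(\<lambda>s. f s * (F s - F a)) absolutely_integrable_on {a..b}"
      by (simp add: mult.commute)
    have "(LINT s|lborel. f0 s * G s) = (LINT s|lebesgue. f0 s * G s)"
      using that(2,4) by (intro integral_completion[symmetric]) auto
    also have "\<dots> = (LINT s|lebesgue. indicator {a..b} s * (f s * (F s - F a)))"
    proof (rule integral_cong_AE)
      show "(\<lambda>s. f0 s * G s) \<in> borel_measurable lebesgue"
        using that(2,4) by (intro measurable_completion) auto
      show "(\<lambda>s. indicator {a..b} s * (f s * (F s - F a))) \<in> borel_measurable lebesgue"
        using i by (auto simp: set_integrable_def dest: borel_measurable_integrable)
      show "AE s in lebesgue. f0 s * G s = indicator {a..b} s * (f s * (F s - F a))"
        using AE_completion[OF f0(1)] by eventually_elim (use G in \<open>auto simp: indicator_def split: if_splits\<close>)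
    qed
    also have "\<dots> = integral {a..b} (\<lambda>s. f s * (F s - F a))"
      using set_lebesgue_integral_eq_integral(2)[OF i] by (simp add: set_lebesgue_integral_def)
    finally show ?thesis .
  qed
  have [measurable]: "(\<lambda>s. LINT t|lborel. indicator {..s} t * q0 t) \<in> borel_measurable borel"
    "(\<lambda>s. LINT t|lborel. indicator {..<s} t * p0 t) \<in> borel_measurable borel"
  proof -
    have "(\<lambda>s. LINT t|lborel. (if t \<le> s then q0 t else 0)) \<in> borel_measurable borel"
      "(\<lambda>s. LINT t|lborel. (if t < s then p0 t else 0)) \<in> borel_measurable borel"
      by measurable
    moreover have "indicator {..s} t * q0 t = (if t \<le> s then q0 t else 0)"
      "indicator {..<s} t * p0 t = (if t < s then p0 t else 0)" for s t
      by (auto simp: indicator_def)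
    ultimately show "(\<lambda>s. LINT t|lborel. indicator {..s} t * q0 t) \<in> borel_measurable borel"
      "(\<lambda>s. LINT t|lborel. indicator {..<s} t * p0 t) \<in> borel_measurable borel"
      by simp_all
  qed
  have "(P b - P a) * (Q b - Q a) = integral {a..b} (\<lambda>s. p s * (Q s - Q a)) + integral {a..b} (\<lambda>s. q s * (P s - P a))"
    unfolding p0I[symmetric] q0I[symmetric] integral_mult_split[OF p0(1) q0(1)]
    using cut[OF p0(2) _ Qs _ cQ 1(1)] cut[OF q0(2) _ Pt _ cP 2(1)] by simp
  also have "\<dots> = integral {a..b} (\<lambda>s. Q s * p s) - integral {a..b} (\<lambda>s. p s * Q a)
      + (integral {a..b} (\<lambda>s. P s * q s) - integral {a..b} (\<lambda>s. q s * P a))"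
    using 1 2 pQ Pq
    by (simp add: right_diff_distrib mult.commute Henstock_Kurzweil_Integration.integral_diff set_lebesgue_integral_eq_integral(1))
  also have "\<dots> = integral {a..b} (\<lambda>s. Q s * p s) - (P b - P a) * Q a
      + (integral {a..b} (\<lambda>s. P s * q s) - (Q b - Q a) * P a)"
    using 1(2) 2(2) by (simp add: integral_unique)
  finally have e: "integral {a..b} (\<lambda>s. Q s * p s) + integral {a..b} (\<lambda>s. P s * q s) = P b * Q b - P a * Q a"
    by (simp add: algebra_simps)
  have "((\<lambda>s. Q s * p s + P s * q s) has_integral (integral {a..b} (\<lambda>s. Q s * p s) + integral {a..b} (\<lambda>s. P s * q s))) {a..b}"
    using pQ Pq by (intro has_integral_add integrable_integral) (simp_all add: set_lebesgue_integral_eq_integral(1))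
  then show "((\<lambda>x. p x * Q x + P x * q x) has_integral P b * Q b - P a * Q a) {a..b}"
    unfolding e by (simp add: mult.commute)
qed

section \<open>Integrals of total derivatives over unbounded intervals\<close>

lemma borel_measurable_lebesgueI:
  "f \<in> borel_measurable borel \<Longrightarrow> f \<in> borel_measurable lebesgue"
  by (simp add: measurable_completion)

lemma set_integrable_lebesgue_subset:
  fixes f :: "real \<Rightarrow> real"
  shows "integrable lebesgue f \<Longrightarrow> A \<in> sets borel \<Longrightarrow> set_integrable lebesgue A f"
  unfolding set_integrable_def by (rule integrable_mult_indicator) auto

lemma primitive_on_set_integral:
  assumes "primitive_on S F f" "a \<le> b" "{a..b} \<subseteq> S"
  shows "(LINT x:{a..b}|lebesgue. f x) = F b - F a"
  using primitive_onD[OF assms] set_lebesgue_integral_eq_integral(2) by (metis integral_unique)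

text \<open>Integrability of \<open>f\<close> makes \<open>F\<close> converge at infinity, and
  integrability of \<open>F\<close> forces the limit to be zero: otherwise
  \<open>\<bar>F\<bar>\<close> would stay above a positive constant on a half-line of infinite
  measure.\<close>

lemma primitive_on_integral_atLeast:
  assumes F: "primitive_on {a..} F f"
    and f_int: "set_integrable lebesgue {a..} f" and F_int: "set_integrable lebesgue {a..} F"
  shows "(LINT x:{a..}|lebesgue. f x) = - F a"
proof -
  let ?I = "LINT x:{a..}|lebesgue. f x"
  have "((\<lambda>b. LINT x:{a..b}|lebesgue. f x) \<longlongrightarrow> ?I) at_top"
    using f_int by (intro tendsto_set_lebesgue_integral_at_top) auto
  then have "((\<lambda>b. F a + (LINT x:{a..b}|lebesgue. f x)) \<longlongrightarrow> F a + ?I) at_top"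
    by (intro tendsto_intros)
  moreover have "\<forall>\<^sub>F b in at_top. F a + (LINT x:{a..b}|lebesgue. f x) = F b"
    using eventually_ge_at_top[of a] by eventually_elim (simp add: primitive_on_set_integral[OF F])
  ultimately have lim: "(F \<longlongrightarrow> F a + ?I) at_top"
    by (simp add: tendsto_cong)
  have "F a + ?I = 0"
  proof (rule ccontr)
    define l where "l = \<bar>F a + ?I\<bar>"
    assume "F a + ?I \<noteq> 0"
    then have l: "l > 0" by (simp add: l_def)
    have "((\<lambda>x. \<bar>F x\<bar>) \<longlongrightarrow> l) at_top"
      unfolding l_def using lim by (rule tendsto_rabs)
    then have "\<forall>\<^sub>F x in at_top. l / 2 < \<bar>F x\<bar>"
      by (rule order_tendstoD) (use l in auto)
    then obtain N0 where N0: "\<And>x. x \<ge> N0 \<Longrightarrow> l / 2 < \<bar>F x\<bar>"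
      by (auto simp: eventually_at_top_linorder)
    define N where "N = max N0 a"
    have N: "\<And>x. x \<ge> N \<Longrightarrow> l / 2 < \<bar>F x\<bar>" "a \<le> N"
      using N0 by (auto simp: N_def)
    have "set_integrable lebesgue {N..} F"
      by (rule set_integrable_subset[OF F_int]) (use N in auto)
    then have i: "integrable lebesgue (\<lambda>x. indicator {N..} x * F x)"
      by (simp add: set_integrable_def)
    have c: "integrable lebesgue (\<lambda>x. indicator {N..} x * (l / 2))"
      by (rule Bochner_Integration.integrable_bound[OF i])
        (use N(1) l in \<open>auto simp: indicator_def abs_mult intro!: borel_measurable_lebesgueI less_imp_le\<close>)
    have "integrable lebesgue (indicator {N..} :: real \<Rightarrow> real)"
      using integrable_mult_left[OF c, of "2 / l"] l by simp
    then have "emeasure lborel {N..} < \<infinity>"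
      by (subst (asm) integrable_indicator_iff) auto
    then obtain m where m: "emeasure lborel {N..} = ennreal m" "m \<ge> 0"
      by (cases "emeasure lborel {N..}") auto
    have "ennreal (m + 1) = emeasure lborel {N..N + (m + 1)}"
      using m by simp
    also have "\<dots> \<le> emeasure lborel {N..}"
      by (intro emeasure_mono) auto
    finally show False using m by (simp add: ennreal_le_iff)
  qed
  then show ?thesis by simp
qed

lemma lebesgue_integral_reflect:
  fixes f :: "real \<Rightarrow> real"
  shows "(LINT x|lebesgue. f (- x)) = (LINT x|lebesgue. f x)"
  using lebesgue_integral_real_affine[of "-1" f 0] by simp

lemma lebesgue_integrable_reflect:
  fixes f :: "real \<Rightarrow> real"
  shows "integrable lebesgue (\<lambda>x. f (- x)) \<longleftrightarrow> integrable lebesgue f"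
  using lebesgue_integrable_real_affine_iff[of "-1" f 0] by simp

lemma primitive_on_integral_UNIV:
  assumes F: "primitive_on UNIV F f"
    and f_int: "integrable lebesgue f" and F_int: "integrable lebesgue F"
  shows "(LINT x|lebesgue. f x) = 0"
proof -
  have r: "(LINT x:{0..}|lebesgue. f x) = - F 0"
    by (intro primitive_on_integral_atLeast primitive_on_subset[OF F] set_integrable_lebesgue_subset f_int F_int) auto
  \<comment> \<open>The left half-line is treated as the right half-line of the reflected function;
    the two boundary values at 0 then cancel.\<close>
  have F': "primitive_on UNIV (\<lambda>x. F (- x)) (\<lambda>x. - f (- x))"
    using primitive_on_reflect[OF F] by simp
  have l: "(LINT x:{0..}|lebesgue. - f (- x)) = - F (- 0)"
    by (intro primitive_on_integral_atLeast primitive_on_subset[OF F'] set_integrable_lebesgue_subset)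
      (use f_int F_int in \<open>auto simp: lebesgue_integrable_reflect\<close>)
  have "(LINT x|lebesgue. f x) = (LINT x|lebesgue. indicator {0..} x * f x + indicator {..0} x * f x)"
  proof (rule integral_cong_AE)
    show "f \<in> borel_measurable lebesgue" using f_int by auto
    show "(\<lambda>x. indicator {0..} x * f x + indicator {..0} x * f x) \<in> borel_measurable lebesgue"
      by (intro borel_measurable_add borel_measurable_integrable
          set_integrable_lebesgue_subset[OF f_int, unfolded set_integrable_def real_scaleR_def]) auto
    show "AE x in lebesgue. f x = indicator {0..} x * f x + indicator {..0} x * f x"
      using AE_completion[OF AE_lborel_singleton[of 0]] by eventually_elim (auto simp: indicator_def)
  qed
  also have "\<dots> = (LINT x|lebesgue. indicator {0..} x * f x) + (LINT x|lebesgue. indicator {..0} x * f x)"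
    using set_integrable_lebesgue_subset[OF f_int]
    by (intro Bochner_Integration.integral_add) (auto simp: set_integrable_def)
  also have "(LINT x|lebesgue. indicator {..0} x * f x) = (LINT x|lebesgue. indicator {0..} x * f (- x))"
    by (subst lebesgue_integral_reflect[symmetric]) (auto simp: indicator_def intro!: Bochner_Integration.integral_cong)
  finally show ?thesis
    using r l by (simp add: set_lebesgue_integral_def)
qed

section \<open>The energy of functions with two zeros\<close>

text \<open>The form domain \<open>H1 \<inter> L2_1\<close> in terms of a continuous representative
  \<open>W\<close> together with a fixed version \<open>w\<close> of its derivative, so that zeros
  of \<open>W\<close> at given points are meaningful.\<close>

definition form_domain :: "(real \<Rightarrow> real) \<Rightarrow> (real \<Rightarrow> real) \<Rightarrow> bool" where
  "form_domain W w \<longleftrightarrow> primitive_on UNIV W w \<and> w \<in> borel_measurable lebesgue \<and>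
     integrable lebesgue (\<lambda>x. (w x)\<^sup>2) \<and> integrable lebesgue (\<lambda>x. (1 + x\<^sup>2) * (W x)\<^sup>2)"

lemma primitive_on_UNIV_continuous:
  assumes "primitive_on UNIV F f"
  shows "continuous_on UNIV F"
proof (rule continuous_at_imp_continuous_on, rule ballI)
  fix x
  have "continuous_on {x - 1..x + 1} F"
    by (rule primitive_on_continuous[OF assms]) auto
  then show "isCont F x"
    by (rule continuous_on_interior) (simp add: interior_atLeastAtMost_real)
qed

lemma form_domainD:
  assumes "form_domain W w"
  shows "primitive_on UNIV W w" "w \<in> borel_measurable lebesgue" "W \<in> borel_measurable lebesgue"
    "integrable lebesgue (\<lambda>x. (w x)\<^sup>2)" "integrable lebesgue (\<lambda>x. (1 + x\<^sup>2) * (W x)\<^sup>2)"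
    "integrable lebesgue (\<lambda>x. (W x)\<^sup>2)" "integrable lebesgue (\<lambda>x. x\<^sup>2 * (W x)\<^sup>2)"
    "continuous_on UNIV W"
proof -
  show 1: "primitive_on UNIV W w" "w \<in> borel_measurable lebesgue"
    "integrable lebesgue (\<lambda>x. (w x)\<^sup>2)" and i: "integrable lebesgue (\<lambda>x. (1 + x\<^sup>2) * (W x)\<^sup>2)"
    using assms by (auto simp: form_domain_def)
  show c: "continuous_on UNIV W" by (rule primitive_on_UNIV_continuous[OF 1(1)])
  then have [measurable]: "W \<in> borel_measurable borel"
    by (rule borel_measurable_continuous_onI)
  then show "W \<in> borel_measurable lebesgue" by (rule borel_measurable_lebesgueI)
  show "integrable lebesgue (\<lambda>x. (W x)\<^sup>2)"
    by (rule Bochner_Integration.integrable_bound[OF i])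
      (auto intro!: borel_measurable_lebesgueI simp: algebra_simps)
  show "integrable lebesgue (\<lambda>x. x\<^sup>2 * (W x)\<^sup>2)"
    by (rule Bochner_Integration.integrable_bound[OF i])
      (auto intro!: borel_measurable_lebesgueI simp: algebra_simps)
qed

lemma square_integrable_mult:
  assumes "f \<in> borel_measurable lebesgue" "g \<in> borel_measurable lebesgue"
    "integrable lebesgue (\<lambda>x. (f x)\<^sup>2)" "integrable lebesgue (\<lambda>x. (g x)\<^sup>2)"
  shows "integrable lebesgue (\<lambda>x. f x * g x :: real)"
proof (rule Bochner_Integration.integrable_bound[OF Bochner_Integration.integrable_add[OF assms(3,4)]])
  show "(\<lambda>x. f x * g x) \<in> borel_measurable lebesgue" using assms by auto
  have "\<bar>u * v\<bar> \<le> u\<^sup>2 + v\<^sup>2" for u v :: real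
  proof -
    have "0 \<le> (\<bar>u\<bar> - \<bar>v\<bar>)\<^sup>2" by simp
    then have "2 * (\<bar>u\<bar> * \<bar>v\<bar>) \<le> u\<^sup>2 + v\<^sup>2" by (simp add: power2_diff)
    moreover have "0 \<le> \<bar>u\<bar> * \<bar>v\<bar>" by simp
    ultimately show ?thesis unfolding abs_mult by linarith
  qed
  then show "AE x in lebesgue. norm (f x * g x) \<le> norm ((f x)\<^sup>2 + (g x)\<^sup>2)"
    by simp
qed

lemma form_domain_add:
  assumes "form_domain U u" "form_domain V v"
  shows "form_domain (\<lambda>x. U x + V x) (\<lambda>x. u x + v x)"
proof -
  note 1 = form_domainD[OF assms(1)] and 2 = form_domainD[OF assms(2)]
  have [measurable]: "u \<in> borel_measurable lebesgue" "v \<in> borel_measurable lebesgue"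
    "U \<in> borel_measurable lebesgue" "V \<in> borel_measurable lebesgue"
    "(\<lambda>x::real. x) \<in> borel_measurable lebesgue"
    using 1 2 by (auto intro: borel_measurable_lebesgueI)
  have p: "(p + q)\<^sup>2 \<le> 2 * p\<^sup>2 + 2 * q\<^sup>2" for p q :: real
    using sum_squares_bound[of p q] by (simp add: power2_sum)
  have "integrable lebesgue (\<lambda>x. (u x + v x)\<^sup>2)"
    by (rule Bochner_Integration.integrable_bound[where f = "\<lambda>x. 2 * (u x)\<^sup>2 + 2 * (v x)\<^sup>2"])
      (use 1 2 p in auto)
  moreover have "integrable lebesgue (\<lambda>x. (1 + x\<^sup>2) * (U x + V x)\<^sup>2)"
  proof (rule Bochner_Integration.integrable_bound[where f = "\<lambda>x. 2 * ((1 + x\<^sup>2) * (U x)\<^sup>2) + 2 * ((1 + x\<^sup>2) * (V x)\<^sup>2)"])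
    have "(1 + x\<^sup>2) * (U x + V x)\<^sup>2 \<le> 2 * ((1 + x\<^sup>2) * (U x)\<^sup>2) + 2 * ((1 + x\<^sup>2) * (V x)\<^sup>2)" for x
      using mult_left_mono[OF p[of "U x" "V x"], of "1 + x\<^sup>2"] by (simp add: algebra_simps)
    then show "AE x in lebesgue. norm ((1 + x\<^sup>2) * (U x + V x)\<^sup>2)
        \<le> norm (2 * ((1 + x\<^sup>2) * (U x)\<^sup>2) + 2 * ((1 + x\<^sup>2) * (V x)\<^sup>2))"
      by (auto simp: abs_mult)
  qed (use 1 2 in auto)
  ultimately show ?thesis
    using 1 2 by (auto simp: form_domain_def intro: primitive_on_add)
qed

lemma form_domain_cmult:
  assumes "form_domain U u"
  shows "form_domain (\<lambda>x. c * U x) (\<lambda>x. c * u x)"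
  using assms unfolding form_domain_def
  by (auto simp: power_mult_distrib mult.left_commute[of _ "c\<^sup>2"] intro: primitive_on_cmult)

lemma form_domain_reflect:
  assumes "form_domain U u"
  shows "form_domain (\<lambda>x. U (- x)) (\<lambda>x. - u (- x))"
proof -
  note 1 = form_domainD[OF assms]
  have "primitive_on UNIV (\<lambda>x. U (- x)) (\<lambda>x. - u (- x))"
    using primitive_on_reflect[OF 1(1)] by simp
  moreover have "(\<lambda>x. - u (- x)) \<in> borel_measurable lebesgue"
    using measurable_compose[OF lebesgue_affine_measurable[where c = "\<lambda>x. -1" and t = "0::real"]] 1(2)
    by simp
  ultimately show ?thesis
    using 1 lebesgue_integrable_reflect[of "\<lambda>x. (u x)\<^sup>2"] lebesgue_integrable_reflect[of "\<lambda>x. (1 + x\<^sup>2) * (U x)\<^sup>2"]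
    by (simp add: form_domain_def)
qed


text \<open>Logarithmic derivatives grow linearly at infinity, so these are the products that
  dominate \<open>r W^2\<close> and its derivative. Each is a product of two square integrable
  functions, one of them being \<open>x * W x\<close> in the last two cases.\<close>

lemma form_domain_integrable_products:
  assumes "form_domain W w"
  shows "integrable lebesgue (\<lambda>x. W x * w x)" "integrable lebesgue (\<lambda>x. x * (W x * w x))"
    "integrable lebesgue (\<lambda>x. x * (W x)\<^sup>2)"
proof -
  note 1 = form_domainD[OF assms]
  have m: "(\<lambda>x. x * W x) \<in> borel_measurable lebesgue"
    by (intro borel_measurable_times 1(3)) (auto intro: borel_measurable_lebesgueI)
  have i: "integrable lebesgue (\<lambda>x. (x * W x)\<^sup>2)" using 1 by (simp add: power_mult_distrib)
  show "integrable lebesgue (\<lambda>x. W x * w x)"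
    by (intro square_integrable_mult 1)
  show "integrable lebesgue (\<lambda>x. x * (W x * w x))"
    using square_integrable_mult[OF m 1(2) i 1(4)] by (simp add: mult.assoc)
  show "integrable lebesgue (\<lambda>x. x * (W x)\<^sup>2)"
    using square_integrable_mult[OF m 1(3) i 1(6)] by (simp add: power2_eq_square mult.assoc)
qed

text \<open>
  Jacobi's trick: a logarithmic derivative \<open>r = p' / p\<close> of a positive supersolution \<open>p\<close> turns the
  quadratic form into \<open>(w - r W)\<^sup>2\<close> plus the total derivative of \<open>r W\<^sup>2\<close>.
\<close>

lemma jacobi_trick:
  fixes r r' :: "real \<Rightarrow> real"
  assumes W: "primitive_on S W w"
    and r: "\<And>x. x \<in> S \<Longrightarrow> (r has_real_derivative r' x) (at x)" "continuous_on S r'"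
  shows "primitive_on S (\<lambda>x. r x * (W x)\<^sup>2) (\<lambda>x. r' x * (W x)\<^sup>2 + r x * (2 * (W x * w x)))"
    and "r' x + (r x)\<^sup>2 \<le> x\<^sup>2 / 4 - l \<Longrightarrow>
      r' x * (W x)\<^sup>2 + r x * (2 * (W x * w x)) \<le> (w x)\<^sup>2 + (x\<^sup>2 / 4 - l) * (W x)\<^sup>2"
proof -
  have "primitive_on S (\<lambda>x. W x * W x) (\<lambda>x. w x * W x + W x * w x)"
    by (rule primitive_on_mult[OF W W])
  then have "primitive_on S (\<lambda>x. (W x)\<^sup>2) (\<lambda>x. 2 * (W x * w x))"
    by (simp add: power2_eq_square mult.commute)
  from primitive_on_mult[OF primitive_on_deriv[OF r] this]
  show "primitive_on S (\<lambda>x. r x * (W x)\<^sup>2) (\<lambda>x. r' x * (W x)\<^sup>2 + r x * (2 * (W x * w x)))" .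
  assume "r' x + (r x)\<^sup>2 \<le> x\<^sup>2 / 4 - l"
  from mult_right_mono[OF this, of "(W x)\<^sup>2"]
  have "(r' x + (r x)\<^sup>2) * (W x)\<^sup>2 \<le> (x\<^sup>2 / 4 - l) * (W x)\<^sup>2" by simp
  moreover have "0 \<le> (w x - r x * W x)\<^sup>2" by simp
  ultimately show "r' x * (W x)\<^sup>2 + r x * (2 * (W x * w x)) \<le> (w x)\<^sup>2 + (x\<^sup>2 / 4 - l) * (W x)\<^sup>2"
    by (simp add: power2_eq_square algebra_simps)
qed

section \<open>Lower energy bounds on the outer and middle intervals\<close>

lemma form_domain_energy_integrable:
  assumes "form_domain W w"
  shows "integrable lebesgue (\<lambda>x. (w x)\<^sup>2 + (x\<^sup>2 / 4 - l) * (W x)\<^sup>2)"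
proof -
  note 1 = form_domainD[OF assms]
  have "integrable lebesgue (\<lambda>x. (w x)\<^sup>2 + (1 / 4 * (x\<^sup>2 * (W x)\<^sup>2) - l * (W x)\<^sup>2))"
    by (intro Bochner_Integration.integrable_add Bochner_Integration.integrable_diff integrable_mult_right 1)
  then show ?thesis by (simp add: algebra_simps)
qed

text \<open>The number 5/2 is the eigenvalue of \<open>- d^2/dx^2 + x^2/4\<close> for the second
  Hermite function, which is positive beyond 1. The condition \<open>1 < a\<close> keeps the pole of
  \<open>r\<close> at 1 away. The boundary term vanishes at \<open>a\<close> because of
  \<open>W a = 0\<close> and at infinity by integrability.\<close>

lemma energy_atLeast_nonneg:
  assumes W: "form_domain W w" and a: "1 < a" and Wa: "W a = 0"
  shows "0 \<le> (LINT x:{a..}|lebesgue. (w x)\<^sup>2 + (x\<^sup>2 / 4 - 5 / 2) * (W x)\<^sup>2)"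
proof -
  note 1 = form_domainD[OF W] and 2 = form_domain_integrable_products[OF W]
  note [measurable] = 1(2,3)
  have [measurable]: "(\<lambda>x::real. x) \<in> borel_measurable lebesgue"
    by (intro borel_measurable_lebesgueI) simp
  \<comment> \<open>logarithmic derivative of the second Hermite function \<open>(x\<^sup>2 - 1) exp (- x\<^sup>2 / 4)\<close>\<close>
  define r where "r x = 2 * x / (x\<^sup>2 - 1) - x / 2" for x :: real
  \<comment> \<open>The Riccati form makes the hypothesis of \<open>jacobi_trick\<close> an
    identity; that it is the derivative of \<open>r\<close> is verified in \<open>d\<close>.\<close>
  define r' where "r' x = x\<^sup>2 / 4 - 5 / 2 - (r x)\<^sup>2" for x :: real
  define f where "f x = r' x * (W x)\<^sup>2 + r x * (2 * (W x * w x))" for x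
  let ?q = "\<lambda>x. (w x)\<^sup>2 + (x\<^sup>2 / 4 - 5 / 2) * (W x)\<^sup>2"
  have a2: "1 < a\<^sup>2" using a by (simp add: one_less_power)
  have x2: "a\<^sup>2 \<le> x\<^sup>2" if "x \<in> {a..}" for x using that a by (simp add: power_mono)
  then have nz: "x\<^sup>2 - 1 \<noteq> 0" "0 < x\<^sup>2 - 1" if "x \<in> {a..}" for x using a2 that by fastforce+
  have c: "continuous_on {a..} r"
    unfolding r_def using nz by (intro continuous_intros) auto
  have c': "continuous_on {a..} r'"
    unfolding r'_def using c by (intro continuous_intros) auto
  have d: "(r has_real_derivative r' x) (at x)" if "x \<in> {a..}" for x
  proof -
    define s where "s = x\<^sup>2 - 1"
    have s: "s \<noteq> 0" "x\<^sup>2 = s + 1" using nz[OF that] by (auto simp: s_def)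
    have "(r has_real_derivative (2 * s - 2 * x * (2 * x)) / (s * s) - 1 / 2) (at x)"
      unfolding r_def s_def using nz(1)[OF that] by (auto intro!: derivative_eq_intros)
    also have "(2 * s - 2 * x * (2 * x)) / (s * s) - 1 / 2 = (2 * s - 4 * x\<^sup>2) / (s * s) - 1 / 2"
      by (simp add: power2_eq_square)
    also have "\<dots> = x\<^sup>2 / 4 - 5 / 2 - (4 * x\<^sup>2 / (s * s) - 2 * x\<^sup>2 / s + x\<^sup>2 / 4)"
      unfolding s(2) using s(1) by (simp add: field_simps)
    also have "4 * x\<^sup>2 / (s * s) - 2 * x\<^sup>2 / s + x\<^sup>2 / 4 = (r x)\<^sup>2"
      unfolding r_def s_def[symmetric] using s(1) by (simp add: power2_eq_square field_simps)
    finally show ?thesis by (simp add: r'_def)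
  qed
  have [measurable]: "r \<in> borel_measurable lebesgue"
    unfolding r_def by (intro borel_measurable_lebesgueI) measurable
  have [measurable]: "r' \<in> borel_measurable lebesgue"
    unfolding r'_def by (intro borel_measurable_diff borel_measurable_power) (auto intro: borel_measurable_lebesgueI)
  \<comment> \<open>In \<open>r x = (2 / (x\<^sup>2 - 1) - 1 / 2) * x\<close> the first term of the
    factor is largest at \<open>x = a\<close>, so \<open>r\<close> grows at most linearly.\<close>
  define K where "K = 1 + 2 / (a\<^sup>2 - 1)"
  have K: "1 \<le> K" using a2 by (simp add: K_def)
  have rb: "\<bar>r x\<bar> \<le> K * \<bar>x\<bar>" if "x \<in> {a..}" for x
  proof -
    have e: "\<bar>r x\<bar> = \<bar>2 / (x\<^sup>2 - 1) - 1 / 2\<bar> * \<bar>x\<bar>"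
      unfolding r_def abs_mult[symmetric] by (simp add: algebra_simps)
    have "2 / (x\<^sup>2 - 1) \<le> 2 / (a\<^sup>2 - 1)"
      using x2[OF that] a2 by (intro divide_left_mono) auto
    moreover have "0 < 2 / (x\<^sup>2 - 1)" using nz[OF that] by simp
    ultimately have "\<bar>2 / (x\<^sup>2 - 1) - 1 / 2\<bar> \<le> K"
      unfolding K_def abs_le_iff by linarith
    then show ?thesis unfolding e by (simp add: mult_right_mono)
  qed
  have F_int: "set_integrable lebesgue {a..} (\<lambda>x. r x * (W x)\<^sup>2)"
    unfolding set_integrable_def
  proof (rule Bochner_Integration.integrable_bound[OF integrable_mult_right[OF 2(3), of K]])
    show "AE x in lebesgue. norm (indicat_real {a..} x *\<^sub>R (r x * (W x)\<^sup>2)) \<le> norm (K * (x * (W x)\<^sup>2))"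
      using rb K by (auto simp: indicator_def abs_mult mult.assoc[symmetric] intro!: mult_right_mono)
  qed (intro borel_measurable_scaleR borel_measurable_times borel_measurable_power; auto intro: borel_measurable_lebesgueI)
  \<comment> \<open>The dominating function for \<open>f\<close>: by the Riccati form,
    \<open>\<bar>r' x\<bar>\<close> is at most
    \<open>(1 + K\<^sup>2) * x\<^sup>2 + 5 / 2\<close>.\<close>
  have b_int: "integrable lebesgue (\<lambda>x. (1 + K\<^sup>2) * (x\<^sup>2 * (W x)\<^sup>2) + 5 / 2 * (W x)\<^sup>2 + 2 * K * \<bar>x * (W x * w x)\<bar>)"
    by (intro Bochner_Integration.integrable_add integrable_mult_right integrable_abs 1 2)
  have f_int: "set_integrable lebesgue {a..} f"
    unfolding set_integrable_def
  proof (rule Bochner_Integration.integrable_bound[OF b_int])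
    have "\<bar>f x\<bar> \<le> (1 + K\<^sup>2) * (x\<^sup>2 * (W x)\<^sup>2) + 5 / 2 * (W x)\<^sup>2 + 2 * K * \<bar>x * (W x * w x)\<bar>"
      if x: "x \<in> {a..}" for x
    proof -
      have "(r x)\<^sup>2 \<le> K\<^sup>2 * x\<^sup>2"
        using power_mono[OF rb[OF x], of 2] by (simp add: power_mult_distrib)
      then have "\<bar>r' x\<bar> \<le> (1 + K\<^sup>2) * x\<^sup>2 + 5 / 2"
        using zero_le_power2[of x] zero_le_power2[of "r x"] zero_le_power2[of "K * x"]
        unfolding r'_def distrib_right mult_1_left power_mult_distrib by linarith
      from mult_right_mono[OF this, of "(W x)\<^sup>2"]
      have "\<bar>r' x * (W x)\<^sup>2\<bar> \<le> (1 + K\<^sup>2) * (x\<^sup>2 * (W x)\<^sup>2) + 5 / 2 * (W x)\<^sup>2"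
        by (simp add: abs_mult algebra_simps)
      moreover have "\<bar>r x * (2 * (W x * w x))\<bar> \<le> 2 * K * \<bar>x * (W x * w x)\<bar>"
        using mult_right_mono[OF rb[OF x], of "2 * \<bar>W x * w x\<bar>"] by (simp add: abs_mult algebra_simps)
      ultimately show ?thesis unfolding f_def by linarith
    qed
    then show "AE x in lebesgue. norm (indicat_real {a..} x *\<^sub>R f x)
        \<le> norm ((1 + K\<^sup>2) * (x\<^sup>2 * (W x)\<^sup>2) + 5 / 2 * (W x)\<^sup>2 + 2 * K * \<bar>x * (W x * w x)\<bar>)"
      using K by (auto simp: indicator_def intro!: AE_I2 order_trans[OF _ abs_ge_self])
    show "(\<lambda>x. indicat_real {a..} x *\<^sub>R f x) \<in> borel_measurable lebesgue"
      unfolding f_def by measurable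
  qed
  have "primitive_on {a..} (\<lambda>x. r x * (W x)\<^sup>2) f"
    unfolding f_def by (rule jacobi_trick(1)[OF primitive_on_subset[OF 1(1)] d c']) auto
  from primitive_on_integral_atLeast[OF this f_int F_int]
  have "(LINT x:{a..}|lebesgue. f x) = 0" using Wa by simp
  moreover have "(LINT x:{a..}|lebesgue. f x) \<le> (LINT x:{a..}|lebesgue. ?q x)"
  proof (rule set_integral_mono[OF f_int])
    show "set_integrable lebesgue {a..} ?q"
      by (intro set_integrable_lebesgue_subset form_domain_energy_integrable[OF W]) auto
    show "f x \<le> ?q x" if "x \<in> {a..}" for x
      unfolding f_def by (rule jacobi_trick(2)[OF primitive_on_subset[OF 1(1)] d c']) (use that in \<open>auto simp: r'_def\<close>)
  qed
  ultimately show ?thesis by simp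
qed

text \<open>When \<open>a > 1\<close> the second Hermite function changes sign inside the interval
  and cannot serve here. The parabola \<open>1 - 4/5 x^2\<close> stays positive as long as
  \<open>x^2 < 5/4\<close>, whence the bound on \<open>a\<close>, and the zeros of \<open>W\<close>
  remove the boundary terms at both ends.\<close>

lemma energy_middle_nonneg:
  assumes W: "form_domain W w" and a: "0 \<le> a" "a\<^sup>2 < 5 / 4" and Wa: "W a = 0" "W (- a) = 0"
  shows "0 \<le> (LINT x:{-a..a}|lebesgue. (w x)\<^sup>2 + (x\<^sup>2 / 4 - 8 / 5) * (W x)\<^sup>2)"
proof -
  note 1 = form_domainD[OF W]
  \<comment> \<open>logarithmic derivative of \<open>1 - 4/5 x\<^sup>2\<close>, a supersolution on this interval\<close>
  define r where "r x = 8 * x / (4 * x\<^sup>2 - 5)" for x :: real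
  \<comment> \<open>With \<open>p = 1 - 4/5 x^2\<close>, the sum \<open>r' + r^2\<close> is
    \<open>p'' / p\<close>, where \<open>p'' = - 8/5\<close>.\<close>
  define r' where "r' x = 8 / (4 * x\<^sup>2 - 5) - (r x)\<^sup>2" for x :: real
  define f where "f x = r' x * (W x)\<^sup>2 + r x * (2 * (W x * w x))" for x
  let ?q = "\<lambda>x. (w x)\<^sup>2 + (x\<^sup>2 / 4 - 8 / 5) * (W x)\<^sup>2"
  have nz: "4 * x\<^sup>2 - 5 \<noteq> 0" "4 * x\<^sup>2 - 5 < 0" if "x \<in> {-a..a}" for x
  proof -
    have "\<bar>x\<bar> \<le> a" using that by auto
    then have "x\<^sup>2 \<le> a\<^sup>2" using power_mono[of "\<bar>x\<bar>" a 2] by simp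
    then show "4 * x\<^sup>2 - 5 \<noteq> 0" "4 * x\<^sup>2 - 5 < 0" using a by auto
  qed
  have c: "continuous_on {-a..a} r"
    unfolding r_def using nz by (intro continuous_intros) auto
  have c': "continuous_on {-a..a} r'"
    unfolding r'_def using c nz by (intro continuous_intros) auto
  have d: "(r has_real_derivative r' x) (at x)" if "x \<in> {-a..a}" for x
  proof -
    define s where "s = 4 * x\<^sup>2 - 5"
    have s: "s \<noteq> 0" using nz[OF that] by (auto simp: s_def)
    have "(r has_real_derivative (8 * s - 8 * x * (4 * (2 * x))) / (s * s)) (at x)"
      unfolding r_def s_def using nz(1)[OF that] by (auto intro!: derivative_eq_intros)
    also have "(8 * s - 8 * x * (4 * (2 * x))) / (s * s) = r' x"
      unfolding r_def r'_def s_def[symmetric] using s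
      by (simp add: power2_eq_square field_simps)
    finally show ?thesis .
  qed
  have p: "primitive_on {-a..a} (\<lambda>x. r x * (W x)\<^sup>2) f"
    unfolding f_def by (rule jacobi_trick(1)[OF primitive_on_subset[OF 1(1)] d c']) auto
  have "(LINT x:{-a..a}|lebesgue. f x) = 0"
    using primitive_on_set_integral[OF p] a Wa by simp
  moreover have "(LINT x:{-a..a}|lebesgue. f x) \<le> (LINT x:{-a..a}|lebesgue. ?q x)"
  proof (rule set_integral_mono)
    show "set_integrable lebesgue {-a..a} f" using primitive_onD(1)[OF p] a by simp
    show "set_integrable lebesgue {-a..a} ?q"
      by (intro set_integrable_lebesgue_subset form_domain_energy_integrable[OF W]) auto
    show "f x \<le> ?q x" if x: "x \<in> {-a..a}" for x
    proof -
      \<comment> \<open>The denominator lies between -5 and 0, so the quotient is at most its value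
        at \<open>x = 0\<close>.\<close>
      have b: "8 / (4 * x\<^sup>2 - 5) \<le> - (8 / 5)"
        using nz[OF x] zero_le_power2[of x] by (simp add: divide_le_eq) (simp add: field_simps)
      have "8 / (4 * x\<^sup>2 - 5) \<le> x\<^sup>2 / 4 - 8 / 5"
        using b zero_le_power2[of x] by linarith
      then show ?thesis
        unfolding f_def
        by (intro jacobi_trick(2)[OF primitive_on_subset[OF 1(1)] d c']) (use x in \<open>auto simp: r'_def\<close>)
    qed
  qed
  ultimately show ?thesis by simp
qed

text \<open>Once 5/2 is weakened to 8/5 on the outer intervals, one constant works on all three; the
  surplus \<open>8/5 - 3/2 = 1/10\<close> is the gap.\<close>

lemma energy_gap_of_zeros:
  assumes W: "form_domain W w" and a: "1 < a" "a\<^sup>2 < 5 / 4" and Wa: "W a = 0" "W (- a) = 0"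
  shows "1 / 10 * (LINT x|lebesgue. (W x)\<^sup>2) \<le> (LINT x|lebesgue. (w x)\<^sup>2 + (x\<^sup>2 / 4 - 3 / 2) * (W x)\<^sup>2)"
proof -
  note 1 = form_domainD[OF W]
  let ?q = "\<lambda>x. (w x)\<^sup>2 + (x\<^sup>2 / 4 - 8 / 5) * (W x)\<^sup>2"
  have q: "integrable lebesgue ?q" by (rule form_domain_energy_integrable[OF W])
  have le: "(LINT x:{a..}|lebesgue. (v x)\<^sup>2 + (x\<^sup>2 / 4 - 5 / 2) * (V x)\<^sup>2)
      \<le> (LINT x:{a..}|lebesgue. (v x)\<^sup>2 + (x\<^sup>2 / 4 - 8 / 5) * (V x)\<^sup>2)" if "form_domain V v" for V v
    by (intro set_integral_mono set_integrable_lebesgue_subset form_domain_energy_integrable[OF that])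
      (auto intro!: mult_right_mono)
  have r: "0 \<le> (LINT x:{a..}|lebesgue. ?q x)"
    using energy_atLeast_nonneg[OF W a(1) Wa(1)] le[OF W] by linarith
  have W': "form_domain (\<lambda>x. W (- x)) (\<lambda>x. - w (- x))" by (rule form_domain_reflect[OF W])
  have "0 \<le> (LINT x:{a..}|lebesgue. ?q (- x))"
    using energy_atLeast_nonneg[OF W' a(1)] le[OF W'] Wa by simp
  also have "(LINT x:{a..}|lebesgue. ?q (- x)) = (LINT x:{..-a}|lebesgue. ?q x)"
    unfolding set_lebesgue_integral_def
    by (subst (2) lebesgue_integral_reflect[symmetric]) (auto simp: indicator_def intro!: Bochner_Integration.integral_cong)
  finally have l: "0 \<le> (LINT x:{..-a}|lebesgue. ?q x)" .
  have m: "0 \<le> (LINT x:{-a..a}|lebesgue. ?q x)"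
    using energy_middle_nonneg[OF W _ a(2) Wa] a by simp
  note qs = set_integrable_lebesgue_subset[OF q, unfolded set_integrable_def real_scaleR_def]
  have "(LINT x|lebesgue. ?q x) = (LINT x|lebesgue. indicator {..-a} x * ?q x +
      (indicator {-a..a} x * ?q x + indicator {a..} x * ?q x))"
  proof (rule integral_cong_AE)
    show "?q \<in> borel_measurable lebesgue" using q by auto
    show "(\<lambda>x. indicator {..-a} x * ?q x + (indicator {-a..a} x * ?q x + indicator {a..} x * ?q x)) \<in> borel_measurable lebesgue"
      by (intro borel_measurable_add borel_measurable_integrable qs) auto
    show "AE x in lebesgue. ?q x = indicator {..-a} x * ?q x + (indicator {-a..a} x * ?q x + indicator {a..} x * ?q x)"
      using AE_completion[OF AE_lborel_singleton[of a]] AE_completion[OF AE_lborel_singleton[of "- a"]]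
      by eventually_elim (use a in \<open>auto simp: indicator_def\<close>)
  qed
  also have "\<dots> = (LINT x:{..-a}|lebesgue. ?q x) + ((LINT x:{-a..a}|lebesgue. ?q x) + (LINT x:{a..}|lebesgue. ?q x))"
    unfolding set_lebesgue_integral_def real_scaleR_def
    using qs[of "{..-a}"] qs[of "{-a..a}"] qs[of "{a..}"]
    by (simp del: distrib_left distrib_right)
  finally have "0 \<le> (LINT x|lebesgue. ?q x)" using l m r by linarith
  also have "(LINT x|lebesgue. ?q x) = (LINT x|lebesgue. ((w x)\<^sup>2 + (x\<^sup>2 / 4 - 3 / 2) * (W x)\<^sup>2) - 1 / 10 * (W x)\<^sup>2)"
    by (intro Bochner_Integration.integral_cong) (auto simp: algebra_simps)
  also have "\<dots> = (LINT x|lebesgue. (w x)\<^sup>2 + (x\<^sup>2 / 4 - 3 / 2) * (W x)\<^sup>2) - 1 / 10 * (LINT x|lebesgue. (W x)\<^sup>2)"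
    using 1(6) form_domain_energy_integrable[OF W, of "3 / 2"] by simp
  finally show ?thesis by simp
qed

section \<open>Test functions and the du Bois-Reymond lemma\<close>

text \<open>Smoothness truncated at order \<open>n\<close>: closure under sums, products and affine
  substitutions can then be proved by induction on \<open>n\<close>.\<close>

definition differentiable_times :: "nat \<Rightarrow> (real \<Rightarrow> real) \<Rightarrow> bool" where
  "differentiable_times n f \<longleftrightarrow> (\<forall>k<n. \<forall>x. (deriv ^^ k) f differentiable (at x))"

lemma differentiable_times_0 [simp]: "differentiable_times 0 f"
  by (simp add: differentiable_times_def)

lemma differentiable_times_Suc:
  "differentiable_times (Suc n) f \<longleftrightarrow> (\<forall>x. f differentiable (at x)) \<and> differentiable_times n (deriv f)"
proof -
  have "differentiable_times (Suc n) f \<longleftrightarrow>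
      (\<forall>x. (deriv ^^ 0) f differentiable (at x)) \<and> (\<forall>k<n. \<forall>x. (deriv ^^ Suc k) f differentiable (at x))"
    unfolding differentiable_times_def by (metis less_Suc_eq_0_disj)
  then show ?thesis
    unfolding differentiable_times_def by (simp add: funpow_Suc_right del: funpow.simps)
qed

lemma differentiable_times_SucI:
  assumes "\<And>x. (f has_real_derivative f' x) (at x)" "differentiable_times n f'"
  shows "differentiable_times (Suc n) f"
proof -
  have "deriv f = f'" using assms(1) by (auto intro: DERIV_imp_deriv)
  then show ?thesis
    using assms by (auto simp: differentiable_times_Suc real_differentiable_def)
qed

lemma differentiable_times_SucD:
  assumes "differentiable_times (Suc n) f"
  shows "(f has_real_derivative deriv f x) (at x)" "differentiable_times n (deriv f)"
  using assms DERIV_imp_deriv unfolding differentiable_times_Suc real_differentiable_def by metis+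

lemma differentiable_times_mono:
  "differentiable_times n f \<Longrightarrow> m \<le> n \<Longrightarrow> differentiable_times m f"
  unfolding differentiable_times_def by auto

lemma differentiable_times_add:
  "differentiable_times n f \<Longrightarrow> differentiable_times n g \<Longrightarrow> differentiable_times n (\<lambda>x. f x + g x)"
proof (induction n arbitrary: f g)
  case (Suc n)
  note 1 = differentiable_times_SucD[OF Suc.prems(1)]
  note 2 = differentiable_times_SucD[OF Suc.prems(2)]
  show ?case
    by (rule differentiable_times_SucI[OF DERIV_add[OF 1(1) 2(1)] Suc.IH[OF 1(2) 2(2)]])
qed simp

lemma differentiable_times_mult:
  "differentiable_times n f \<Longrightarrow> differentiable_times n g \<Longrightarrow> differentiable_times n (\<lambda>x. f x * g x)"
proof (induction n arbitrary: f g)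
  case (Suc n)
  note 1 = differentiable_times_SucD[OF Suc.prems(1)]
  note 2 = differentiable_times_SucD[OF Suc.prems(2)]
  have "differentiable_times n (\<lambda>x. deriv f x * g x + deriv g x * f x)"
    by (intro differentiable_times_add Suc.IH 1 2)
      (use Suc.prems in \<open>auto intro: differentiable_times_mono\<close>)
  then show ?case
    by (rule differentiable_times_SucI[OF DERIV_mult[OF 1(1) 2(1)]])
qed simp

text \<open>The factor \<open>k\<close> is part of the induction because every differentiation
  multiplies it by \<open>c\<close>.\<close>

lemma differentiable_times_affine:
  "differentiable_times n f \<Longrightarrow> differentiable_times n (\<lambda>x. k * f (c * x + d))"
proof (induction n arbitrary: f k)
  case (Suc n)
  note 1 = differentiable_times_SucD[OF Suc.prems]
  show ?case
  proof (rule differentiable_times_SucI)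
    show "((\<lambda>x. k * f (c * x + d)) has_real_derivative (k * c) * deriv f (c * x + d)) (at x)" for x
      by (auto intro!: derivative_eq_intros DERIV_chain2[OF 1(1)])
    show "differentiable_times n (\<lambda>x. (k * c) * deriv f (c * x + d))"
      by (rule Suc.IH[OF 1(2)])
  qed
qed simp

section \<open>A smooth ramp built from exp(-1/x)\<close>

lemma tendsto_power_mult_poly_div_exp:
  fixes p :: "real poly"
  shows "((\<lambda>t. t ^ k * poly p t / exp t) \<longlongrightarrow> 0) at_top"
\<comment> \<open>The exponent is generalised because splitting off the lowest coefficient turns
  \<open>t ^ k\<close> into \<open>t ^ Suc k\<close>.\<close>
proof (induction p arbitrary: k)
  case (pCons a p)
  have "((\<lambda>t. a * (t ^ k / exp t) + t ^ Suc k * poly p t / exp t) \<longlongrightarrow> a * 0 + 0) at_top"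
    by (intro tendsto_intros tendsto_power_div_exp_0 pCons.IH)
  moreover have "a * (t ^ k / exp t) + t ^ Suc k * poly p t / exp t = t ^ k * poly (pCons a p) t / exp t" for t
    by (simp add: algebra_simps add_divide_distrib)
  ultimately show ?case by simp
qed simp

text \<open>\<open>flat 1\<close> is the classical smooth function that is flat at 0; the polynomial
  parameter makes the family closed under differentiation.\<close>

definition flat :: "real poly \<Rightarrow> real \<Rightarrow> real" where
  "flat p x = (if x \<le> 0 then 0 else poly p (1 / x) * exp (- (1 / x)))"

text \<open>In the variable \<open>t = 1 / x\<close> differentiation is \<open>- t^2 d/dt\<close>,
  which sends \<open>p exp (- t)\<close> to \<open>t^2 (p - p') exp (- t)\<close>; the polynomial
  \<open>[:0, 0, 1:]\<close> is \<open>t^2\<close>.\<close>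

lemma flat_has_derivative:
  "(flat p has_real_derivative flat ([:0, 0, 1:] * (p - pderiv p)) x) (at x)"
proof -
  consider "x < 0" | "x > 0" | "x = 0" by linarith
  then show ?thesis
  proof cases
    case 1
    have "((\<lambda>x. 0) has_real_derivative flat ([:0, 0, 1:] * (p - pderiv p)) x) (at x)"
      using 1 by (simp add: flat_def)
    moreover have "\<forall>\<^sub>F y in nhds x. flat p y = 0"
      using eventually_nhds_in_open[of "{..<0}" x] 1 by (auto elim!: eventually_mono simp: flat_def)
    ultimately show ?thesis
      using DERIV_cong_ev[OF refl _ refl, of "flat p" "\<lambda>x. 0"] by blast
  next
    case 2
    have "((\<lambda>x. poly p (1 / x) * exp (- (1 / x))) has_real_derivative
        flat ([:0, 0, 1:] * (p - pderiv p)) x) (at x)"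
    proof -
      have "((\<lambda>x. 1 / x) has_real_derivative - (1 / x\<^sup>2)) (at x)"
        using 2 by (auto intro!: derivative_eq_intros simp: power2_eq_square)
      from DERIV_mult[OF DERIV_chain2[OF poly_DERIV this] DERIV_chain2[OF DERIV_exp DERIV_minus[OF this]]]
      show ?thesis
        by (rule DERIV_cong) (use 2 in \<open>simp add: flat_def power2_eq_square field_simps\<close>)
    qed
    moreover have "\<forall>\<^sub>F y in nhds x. flat p y = poly p (1 / y) * exp (- (1 / y))"
      using eventually_nhds_in_open[of "{0<..}" x] 2 by (auto elim!: eventually_mono simp: flat_def)
    ultimately show ?thesis
      using DERIV_cong_ev[OF refl _ refl, of "flat p" "\<lambda>x. poly p (1 / x) * exp (- (1 / x))"] by blast
  next
    case 3
    have "((\<lambda>h. (flat p (0 + h) - flat p 0) / h) \<longlongrightarrow> 0) (at 0)"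
    proof (rule filterlim_split_at)
      show "((\<lambda>h. (flat p (0 + h) - flat p 0) / h) \<longlongrightarrow> 0) (at_left 0)"
        by (rule tendsto_eventually)
          (auto simp: flat_def eventually_at_left_field intro!: exI[of _ "- 1"])
      \<comment> \<open>With \<open>t = 1 / h\<close> the right difference quotient at 0 is
        \<open>t * poly p t / exp t\<close>, where the exponential wins.\<close>
      have "((\<lambda>h. inverse h ^ 1 * poly p (inverse h) / exp (inverse h)) \<longlongrightarrow> 0) (at_right 0)"
        by (rule filterlim_compose[OF tendsto_power_mult_poly_div_exp filterlim_inverse_at_top_right])
      moreover have "\<forall>\<^sub>F h in at_right 0. inverse h ^ 1 * poly p (inverse h) / exp (inverse h)
          = (flat p (0 + h) - flat p 0) / h"
        by (rule eventually_at_rightI[of 0 1]) (auto simp: flat_def field_simps exp_minus)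
      ultimately show "((\<lambda>h. (flat p (0 + h) - flat p 0) / h) \<longlongrightarrow> 0) (at_right 0)"
        using tendsto_cong by fast
    qed
    then show ?thesis using 3 by (simp add: DERIV_def flat_def)
  qed
qed

lemma differentiable_times_flat: "differentiable_times n (flat p)"
  by (induction n arbitrary: p) (auto intro: differentiable_times_SucI flat_has_derivative)

lemma antiderivative_exists:
  fixes f :: "real \<Rightarrow> real"
  assumes "\<And>x. isCont f x"
  obtains F where "\<And>x. (F has_real_derivative f x) (at x)"
  using einterval_antiderivative[of "-\<infinity>" \<infinity> f] assms
  by (auto simp: has_real_derivative_iff_has_vector_derivative)

text \<open>A bump on \<open>[0, 1]\<close> is integrated twice: normalised, the first integral is a
  smooth step \<open>S\<close>, the second a ramp \<open>T\<close>. Test functions are later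
  assembled from \<open>T\<close> so that their derivatives, assembled from \<open>S\<close>,
  approximate indicators of intervals.\<close>

lemma smooth_ramp_exists:
  obtains T S :: "real \<Rightarrow> real"
  where "\<And>n. differentiable_times n T" "\<And>x. (T has_real_derivative S x) (at x)"
    "\<And>x. x \<le> 0 \<Longrightarrow> T x = 0 \<and> S x = 0" "\<And>x. x \<ge> 1 \<Longrightarrow> T x = T 1 + (x - 1) \<and> S x = 1"
    "\<And>x. 0 \<le> S x" "\<And>x. S x \<le> 1"
proof -
  \<comment> \<open>A bump positive exactly on \<open>(0, 1)\<close>; the second factor is spelled
    as an affine substitution to match \<open>differentiable_times_affine\<close>.\<close>
  define e where "e x = flat 1 x * (1 * flat 1 ((- 1) * x + 1))" for x
  have smooth: "differentiable_times n e" for n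
    unfolding e_def by (intro differentiable_times_mult differentiable_times_affine differentiable_times_flat)
  then have "differentiable_times (Suc 0) e" by blast
  then have cont: "isCont e x" for x
    by (auto simp: differentiable_times_Suc intro: differentiable_imp_continuous_within)
  have e0: "e x = 0" if "x \<le> 0 \<or> 1 \<le> x" for x using that by (auto simp: e_def flat_def)
  have epos: "e x > 0" if "0 < x" "x < 1" for x using that by (simp add: e_def flat_def)
  have enn: "e x \<ge> 0" for x using e0[of x] epos[of x] by fastforce
  obtain F where F: "\<And>x. (F has_real_derivative e x) (at x)"
    using antiderivative_exists[OF cont] by blast
  have mono: "F x \<le> F y" if "x \<le> y" for x y
    by (rule DERIV_nonneg_imp_nondecreasing[OF that]) (use F enn in blast)
  have Fl: "F x = F 0" if "x \<le> 0" for x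
  proof (cases "x = 0")
    case False
    then obtain z where "x < z" "z < 0" "F 0 - F x = (0 - x) * e z"
      using MVT2[of x 0 F e] F \<open>x \<le> 0\<close> by auto
    then show ?thesis using e0[of z] by simp
  qed simp
  have Fr: "F x = F 1" if "1 \<le> x" for x
  proof (cases "x = 1")
    case False
    then obtain z where "1 < z" "z < x" "F x - F 1 = (x - 1) * e z"
      using MVT2[of 1 x F e] F \<open>1 \<le> x\<close> by auto
    then show ?thesis using e0[of z] by simp
  qed simp
  define I where "I = F 1 - F 0"
  obtain z where "0 < z" "z < 1" "F 1 - F 0 = (1 - 0) * e z"
    using MVT2[of 0 1 F e] F by auto
  then have I: "I > 0" using epos[of z] by (simp add: I_def)
  \<comment> \<open>Dividing by the integral \<open>I\<close> of the bump makes \<open>S\<close>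
    rise from 0 to 1. The trivial substitution \<open>1 * x + 0\<close> again gives the derivative
    the shape required by \<open>differentiable_times_affine\<close>.\<close>
  define S where "S x = 1 / I * F (1 * x + 0) + (- F 0 / I)" for x
  have dS: "(S has_real_derivative 1 / I * e (1 * x + 0)) (at x)" for x
    unfolding S_def using F[of x] I by (auto intro!: derivative_eq_intros)
  have smoothS: "differentiable_times n S" for n
  proof -
    have "differentiable_times (Suc n) S"
      by (rule differentiable_times_SucI[OF dS differentiable_times_affine[OF smooth]])
    then show ?thesis by (rule differentiable_times_mono) simp
  qed
  have S_eq: "S x = (F x - F 0) / I" for x
    by (simp add: S_def diff_divide_distrib)
  have S: "S x = 0" if "x \<le> 0" for x using Fl[OF that] by (simp add: S_eq)
  have S': "S x = 1" if "1 \<le> x" for x using Fr[OF that] I by (simp add: S_eq I_def)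
  have Snn: "0 \<le> S x" for x
    using mono[of 0 x] Fl[of x] I by (cases "x \<le> 0") (auto simp: S_eq)
  have Sle: "S x \<le> 1" for x
    using mono[of x 1] Fr[of x] I by (cases "x \<le> 1") (auto simp: S_eq I_def)
  obtain T0 where T0: "\<And>x. (T0 has_real_derivative S x) (at x)"
    using antiderivative_exists[OF DERIV_isCont[OF dS]] by blast
  define T where "T x = T0 x - T0 0" for x
  have dT: "(T has_real_derivative S x) (at x)" for x
    unfolding T_def using T0[of x] by (auto intro!: derivative_eq_intros)
  have smoothT: "differentiable_times n T" for n
    by (rule differentiable_times_mono[OF differentiable_times_SucI[OF dT smoothS[of n]]]) simp
  have Tl: "T x = 0" if "x \<le> 0" for x
  proof (cases "x = 0")
    case False
    then obtain z where "x < z" "z < 0" "T 0 - T x = (0 - x) * S z"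
      using MVT2[of x 0 T S] dT \<open>x \<le> 0\<close> by auto
    then show ?thesis using S[of z] by (simp add: T_def)
  qed (simp add: T_def)
  have Tr: "T x = T 1 + (x - 1)" if "1 \<le> x" for x
  proof (cases "x = 1")
    case False
    then obtain z where "1 < z" "z < x" "T x - T 1 = (x - 1) * S z"
      using MVT2[of 1 x T S] dT \<open>1 \<le> x\<close> by auto
    then show ?thesis using S'[of z] by simp
  qed simp
  show ?thesis
  proof (rule that)
    show "T x = T 1 + (x - 1) \<and> S x = 1" if "1 \<le> x" for x
      using Tr[OF that] S'[OF that] by blast
  qed (simp_all add: smoothT dT Tl S Snn Sle)
qed

section \<open>Test functions and functions with vanishing integrals\<close>

lemma test_functionsI:
  assumes "\<And>n. differentiable_times n f" "\<And>x. x < A \<or> B < x \<Longrightarrow> f x = 0"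
  shows "f \<in> test_functions"
proof -
  have "(deriv ^^ n) f differentiable at x" for n x
    using assms(1)[of "Suc n"] by (simp add: differentiable_times_def del: funpow.simps)
  moreover have "closure {x. f x \<noteq> 0} \<subseteq> {A..B}"
    by (rule closure_minimal) (use assms(2) in \<open>auto simp: not_less[symmetric]\<close>)
  then have "compact (closure {x. f x \<noteq> 0})"
    by (meson bounded_closed_interval bounded_subset closed_closure compact_eq_bounded_closed)
  ultimately show ?thesis by (simp add: test_functions_def)
qed

lemma test_functionsE:
  assumes "f \<in> test_functions"
  obtains A B where "A \<le> B" "\<And>x. x \<notin> {A..B} \<Longrightarrow> f x = 0" "\<And>x. x \<notin> {A..B} \<Longrightarrow> deriv f x = 0"
    "\<And>x. (f has_real_derivative deriv f x) (at x)" "continuous_on UNIV f" "continuous_on UNIV (deriv f)"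
proof -
  have d: "(deriv ^^ n) f differentiable at x" for n x
    using assms by (simp add: test_functions_def)
  have 1: "(f has_real_derivative deriv f x) (at x)" for x
    using d[of 0 x] DERIV_imp_deriv by (force simp: real_differentiable_def)
  have 2: "continuous_on UNIV f" "continuous_on UNIV (deriv f)"
    using d[of 0] d[of 1] by (auto intro!: continuous_at_imp_continuous_on differentiable_imp_continuous_within)
  have "bounded (closure {x. f x \<noteq> 0})"
    using assms compact_imp_bounded by (auto simp: test_functions_def)
  then obtain K where K: "\<And>x. x \<in> closure {x. f x \<noteq> 0} \<Longrightarrow> \<bar>x\<bar> \<le> K"
    by (auto simp: bounded_real)
  define M where "M = max K 0"
  have z: "f x = 0" if "x \<notin> {-M..M}" for x
    using K[of x] that closure_subset[of "{x. f x \<noteq> 0}"] by (fastforce simp: M_def)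
  have "deriv f x = 0" if "x \<notin> {-M..M}" for x
  proof -
    have "\<forall>\<^sub>F y in nhds x. f y = 0"
      using eventually_nhds_in_open[of "- {-M..M}" x] that z by (auto elim!: eventually_mono simp: open_Compl)
    then have "(f has_real_derivative 0) (at x)"
      using DERIV_cong_ev[OF refl _ refl, of f "\<lambda>x. 0" x 0] by simp
    then show ?thesis by (rule DERIV_imp_deriv)
  qed
  then show ?thesis using that[of "-M" M] z 1 2 by (auto simp: M_def)
qed

lemma integrable_compact_mult:
  fixes f \<phi> :: "real \<Rightarrow> real"
  assumes f: "f absolutely_integrable_on {A..B}" and \<phi>: "continuous_on UNIV \<phi>" "\<And>x. x \<notin> {A..B} \<Longrightarrow> \<phi> x = 0"
  shows "integrable lebesgue (\<lambda>x. f x * \<phi> x)"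
proof -
  have "(\<lambda>x. \<phi> x * f x) absolutely_integrable_on {A..B}"
    by (rule absolutely_integrable_bounded_measurable_product_real)
      (use f continuous_on_subset[OF \<phi>(1)] in
        \<open>auto intro!: continuous_imp_measurable_on_sets_lebesgue compact_imp_bounded compact_continuous_image\<close>)
  then have "integrable lebesgue (\<lambda>x. indicator {A..B} x * (\<phi> x * f x))"
    by (simp add: set_integrable_def)
  moreover have "indicator {A..B} x * (\<phi> x * f x) = f x * \<phi> x" for x
    using \<phi>(2)[of x] by (auto simp: indicator_def)
  ultimately show ?thesis by simp
qed

text \<open>The half-lines \<open>{..a}\<close> are closed under intersection and generate the Borel
  sets, so vanishing integrals spread to all Borel sets by Dynkin's argument; the vanishing total
  integral handles complements. Then \<open>h\<close> has the same density measure as 0.\<close>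

lemma lborel_AE_zero_of_intervals:
  fixes h :: "real \<Rightarrow> real"
  assumes h: "integrable lborel h" and zero: "\<And>a. (LINT x:{..a}|lborel. h x) = 0" "(LINT x|lborel. h x) = 0"
  shows "AE x in lborel. h x = 0"
proof (rule density_unique_real[OF h integrable_zero])
  have set_int: "set_integrable lborel A h" if "A \<in> sets borel" for A
    using that h unfolding set_integrable_def by (intro integrable_mult_indicator) auto
  have *: "sets (borel :: real measure) = sigma_sets UNIV (range (\<lambda>a. {..a}))"
    by (subst borel_eq_atMost) simp
  fix A :: "real set" assume "A \<in> sets lborel"
  then have A: "A \<in> sigma_sets UNIV (range (\<lambda>a. {..a}))"
    by (simp add: *)
  have IS: "Int_stable (range (\<lambda>a::real. {..a}))"
    by (auto simp: Int_stable_def)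
  have sub: "range (\<lambda>a::real. {..a}) \<subseteq> Pow UNIV" by simp
  show "(LINT x:A|lborel. h x) = (LINT x:A|lborel. 0)"
    unfolding set_lebesgue_integral_zero using IS sub A
  proof (induction rule: sigma_sets_induct_disjoint)
    case (basic A)
    then show ?case using zero(1) by auto
  next
    case empty
    then show ?case by (simp add: set_lebesgue_integral_def)
  next
    case (compl A)
    then have A: "A \<in> sets borel" by (simp add: *)
    have "(LINT x|lborel. h x) = (LINT x|lborel. indicator A x * h x + indicator (UNIV - A) x * h x)"
      by (intro Bochner_Integration.integral_cong) (auto simp: indicator_def)
    also have "\<dots> = (LINT x:A|lborel. h x) + (LINT x:UNIV - A|lborel. h x)"
      using set_int[of A] set_int[of "UNIV - A"] A
      unfolding set_lebesgue_integral_def set_integrable_def real_scaleR_def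
      by (intro Bochner_Integration.integral_add) auto
    finally show ?case using compl zero(2) by simp
  next
    case (union A)
    then have "A i \<in> sets borel" for i by (auto simp: *)
    then have "(LINT x:(\<Union>i. A i)|lborel. h x) = (\<Sum>i. (LINT x:(A i)|lborel. h x))"
      by (intro lebesgue_integral_countable_add set_int) (use union in \<open>auto simp: disjoint_family_on_def\<close>)
    then show ?case using union by simp
  qed
qed

text \<open>\<open>H\<close> is only locally integrable, so the argument is run on its cut-offs to
  \<open>[-n, n]\<close>, whose integrals over half-lines are integrals of \<open>H\<close> over
  intervals; countably many null sets are then united.\<close>

lemma AE_zero_of_intervals:
  fixes H :: "real \<Rightarrow> real"
  assumes H: "\<And>a b. H absolutely_integrable_on {a..b}"
    and zero: "\<And>a b. a \<le> b \<Longrightarrow> (LINT x:{a..b}|lebesgue. H x) = 0"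
  shows "AE x in lebesgue. H x = 0"
proof -
  have "AE x in lebesgue. indicator {- real n..real n} x * H x = 0" for n
  proof -
    let ?I = "{- real n..real n}"
    obtain h where h: "integrable lborel h" "AE x in lborel. indicator ?I x * H x = h x"
      using absolutely_integrable_borel_version[OF H] .
    have hI: "(LINT x|lborel. indicator {a..b} x * h x) = 0" if "a \<le> b" "{a..b} \<subseteq> ?I" for a b
    proof (rule integral_borel_version[OF h(2,1) _ that(2) _ H])
      show "(H has_integral 0) {a..b}"
        using has_integral_set_lebesgue[OF H, of a b] zero[OF that(1)] by simp
    qed simp
    have cut: "(LINT x|lborel. indicator A x * h x) = (LINT x|lborel. indicator (A \<inter> ?I) x * h x)"
      if "A \<in> sets borel" for A
      by (rule integral_cong_AE) (use that h in \<open>auto elim!: eventually_mono simp: indicator_def split: if_splits\<close>)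
    have "AE x in lborel. h x = 0"
    proof (rule lborel_AE_zero_of_intervals[OF h(1)])
      show "(LINT x|lborel. h x) = 0"
        using cut[of UNIV] hI[of "- real n" "real n"] by simp
      show "(LINT x:{..a}|lborel. h x) = 0" for a
      proof -
        have "{..a} \<inter> ?I = {- real n..min a (real n)}" by auto
        moreover have "(LINT x|lborel. indicator {- real n..min a (real n)} x * h x) = 0"
        proof (cases "- real n \<le> min a (real n)")
          case True
          then show ?thesis by (intro hI) auto
        next
          case False
          then show ?thesis by (simp add: atLeastatMost_empty)
        qed
        ultimately show ?thesis using cut[of "{..a}"] by (simp add: set_lebesgue_integral_def)
      qed
    qed
    then have "AE x in lborel. indicator ?I x * H x = 0"
      using h(2) by eventually_elim simp
    then show ?thesis by (rule AE_completion)
  qed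
  then have "AE x in lebesgue. \<forall>n. indicator {- real n..real n} x * H x = 0"
    unfolding AE_all_countable by blast
  then show ?thesis
  proof eventually_elim
    case (elim x)
    obtain n where "\<bar>x\<bar> \<le> real n" using real_arch_simple by blast
    then show ?case using elim[rule_format, of n] by (auto simp: indicator_def abs_le_iff)
  qed
qed

text \<open>The integral of \<open>H\<close> over any interval is compared with the mean
  \<open>c\<close> of \<open>H\<close> over the reference interval \<open>[0, 1]\<close>. The two
  are linked by a step function of integral zero, which is a limit of derivatives of test functions;
  hence \<open>H - c\<close> integrates to zero over every interval.\<close>

lemma du_Bois_Reymond:
  fixes H :: "real \<Rightarrow> real"
  assumes H: "\<And>a b. H absolutely_integrable_on {a..b}"
    and weak: "\<And>\<phi>. \<phi> \<in> test_functions \<Longrightarrow> (LINT x|lebesgue. H x * deriv \<phi> x) = 0"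
  obtains c where "AE x in lebesgue. H x = c"
proof -
  obtain T S :: "real \<Rightarrow> real"
    where T: "\<And>n. differentiable_times n T" and dT: "\<And>x. (T has_real_derivative S x) (at x)"
      and left: "\<And>x. x \<le> 0 \<Longrightarrow> T x = 0 \<and> S x = 0"
      and right: "\<And>x. x \<ge> 1 \<Longrightarrow> T x = T 1 + (x - 1) \<and> S x = 1"
      and S: "\<And>x. 0 \<le> S x" "\<And>x. S x \<le> 1"
    using smooth_ramp_exists by blast
  define c where "c = (LINT x:{0..1}|lebesgue. H x)"
  have key: "(LINT x:{p..q}|lebesgue. H x) = c * (q - p)" if pq: "p < q" for p q
  proof -
    \<comment> \<open>\<open>\<phi> n\<close> is a smoothing at scale \<open>1 / N n\<close> of the compactly supported primitive of
        the indicator of \<open>(p, q]\<close> minus \<open>q - p\<close> times the indicator of \<open>(0, 1]\<close>\<close>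
    define N where "N n = real (Suc n)" for n
    have N: "N n \<ge> 1" for n by (simp add: N_def)
    define \<phi> where "\<phi> n x = (1 / N n) * T (N n * x + - (N n * p)) + (- (1 / N n)) * T (N n * x + - (N n * q))
      + ((- (q - p) / N n) * T (N n * x + 0) + ((q - p) / N n) * T (N n * x + - N n))" for n x
    define D where "D n x = S (N n * x + - (N n * p)) - S (N n * x + - (N n * q))
      - (q - p) * (S (N n * x + 0) - S (N n * x + - N n))" for n x
    define A where "A = min p 0"
    \<comment> \<open>The extra 1 leaves room for the ramps starting at \<open>q\<close> and 1 to
      become linear, which takes length \<open>1 / N n\<close>, at most 1.\<close>
    define B where "B = max q 1 + 1"
    have out: "\<phi> n x = 0 \<and> D n x = 0" if x: "x < A \<or> B < x" for n x
    proof (cases "x < A")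
      case True
      then have "x \<le> p" "x \<le> q" "x \<le> 0" "x \<le> 1" using pq by (auto simp: A_def)
      then have "N n * x \<le> N n * p" "N n * x \<le> N n * q" "N n * x \<le> N n * 0" "N n * x \<le> N n * 1"
        using N[of n] by (intro mult_left_mono; simp)+
      then show ?thesis by (simp add: \<phi>_def D_def left)
    next
      case False
      then have "x \<ge> q + 1" "x \<ge> p + 1" "x \<ge> 0 + 1" "x \<ge> 1 + 1" using x pq by (auto simp: B_def)
      then have "N n * x \<ge> N n * (q + 1)" "N n * x \<ge> N n * (p + 1)" "N n * x \<ge> N n * (0 + 1)" "N n * x \<ge> N n * (1 + 1)"
        using N[of n] by (intro mult_left_mono; simp)+
      then have ge: "N n * x + - (N n * p) \<ge> 1" "N n * x + - (N n * q) \<ge> 1" "N n * x + 0 \<ge> 1" "N n * x + - N n \<ge> 1"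
        using N[of n] unfolding distrib_left mult_1_right mult_zero_right by linarith+
      \<comment> \<open>All four ramps are linear here: the first pair contributes
        \<open>q - p\<close>, the second pair its negative.\<close>
      show ?thesis
        unfolding \<phi>_def D_def right[OF ge(1), THEN conjunct1] right[OF ge(2), THEN conjunct1]
          right[OF ge(3), THEN conjunct1] right[OF ge(4), THEN conjunct1] right[OF ge(1), THEN conjunct2]
          right[OF ge(2), THEN conjunct2] right[OF ge(3), THEN conjunct2] right[OF ge(4), THEN conjunct2]
        using N[of n] by (simp add: field_simps)
    qed
    have smooth: "differentiable_times m (\<phi> n)" for m n
      unfolding \<phi>_def by (intro differentiable_times_add differentiable_times_affine T)
    have test: "\<phi> n \<in> test_functions" for n
      by (rule test_functionsI[OF smooth]) (use out in auto)
    have "(\<phi> n has_real_derivative D n x) (at x)" for n x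
    proof -
      have *: "((\<lambda>x. k * T (N n * x + d)) has_real_derivative k * (S (N n * x + d) * N n)) (at x)" for k d
        by (auto intro!: derivative_eq_intros DERIV_chain2[OF dT])
      show ?thesis
        unfolding \<phi>_def
        by (rule DERIV_cong[OF DERIV_add[OF DERIV_add[OF * *] DERIV_add[OF * *]]])
          (use N[of n] in \<open>simp add: D_def field_simps\<close>)
    qed
    then have "deriv (\<phi> n) = D n" for n
      by (auto intro: DERIV_imp_deriv)
    then have zero: "(LINT x|lebesgue. H x * D n x) = 0" for n
      using weak[OF test[of n]] by simp
    define L where "L x = indicator {p<..q} x - (q - p) * indicator {0<..1} x" for x :: real
    \<comment> \<open>Since \<open>S 0 = 0\<close>, the limit at \<open>x = d\<close> is 0; this is
      why the intervals in \<open>L\<close> are open on the left and closed on the right.\<close>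
    have lim1: "(\<lambda>n. S (N n * x + - (N n * d))) \<longlonglongrightarrow> (if d < x then 1 else 0)" for x d
    proof (cases "d < x")
      case True
      have "filterlim (\<lambda>n. N n * (x - d)) at_top sequentially"
        unfolding N_def using True
        by (intro filterlim_at_top_mult_tendsto_pos[where c = "x - d"]
          filterlim_compose[OF filterlim_real_sequentially filterlim_Suc] tendsto_const; simp)
      then have "\<forall>\<^sub>F n in sequentially. 1 \<le> N n * (x - d)"
        by (simp add: filterlim_at_top)
      then have "\<forall>\<^sub>F n in sequentially. S (N n * x + - (N n * d)) = 1"
        by eventually_elim (use right in \<open>simp add: algebra_simps\<close>)
      then show ?thesis using True by (simp add: tendsto_eventually)
    next
      case False
      then have "N n * x + - (N n * d) \<le> 0" for n
        using N[of n] by (simp add: mult_left_mono)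
      then show ?thesis using False left by simp
    qed
    have Dlim: "(\<lambda>n. D n x) \<longlonglongrightarrow> L x" for x
    proof -
      have "(\<lambda>n. D n x) \<longlonglongrightarrow> (if p < x then 1 else 0) - (if q < x then 1 else 0)
          - (q - p) * ((if 0 < x then 1 else 0) - (if 1 < x then 1 else 0))"
        unfolding D_def using lim1[of x 0] lim1[of x 1]
        by (intro tendsto_diff tendsto_mult tendsto_const lim1) auto
      moreover have "(if p < x then 1 else 0) - (if q < x then 1 else 0)
          - (q - p) * ((if 0 < x then 1 else 0) - (if 1 < x then 1 else 0)) = L x"
        using pq by (auto simp: L_def indicator_def)
      ultimately show ?thesis by simp
    qed
    have Hm: "integrable lebesgue (\<lambda>x. indicator {A..B} x * H x)"
      using H by (simp add: set_integrable_def)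
    have Db: "\<bar>D n x\<bar> \<le> 1 + (q - p)" for n x
    proof -
      have "\<bar>S u - S v\<bar> \<le> 1" for u v using S[of u] S[of v] by (simp add: abs_le_iff)
      then have "\<bar>S (N n * x + - (N n * p)) - S (N n * x + - (N n * q))\<bar> \<le> 1"
        "\<bar>(q - p) * (S (N n * x + 0) - S (N n * x + - N n))\<bar> \<le> q - p"
        using pq by (simp_all add: abs_mult mult_left_le)
      then show ?thesis unfolding D_def by linarith
    qed
    \<comment> \<open>The common support lets \<open>H\<close> be replaced by its integrable
      cut-off, which supplies the dominating function for the limit.\<close>
    have HD: "H x * D n x = (indicator {A..B} x * H x) * D n x" for n x
      using out[of x n] by (cases "x < A \<or> B < x") (auto simp: indicator_def not_less)
    have HL: "H x * L x = (indicator {A..B} x * H x) * L x" for x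
      using pq by (auto simp: indicator_def L_def A_def B_def)
    have Dm: "D n \<in> borel_measurable lebesgue" for n
    proof -
      have "continuous_on UNIV (deriv (\<phi> n))"
        using test_functionsE[OF test] by metis
      then show ?thesis
        using \<open>deriv (\<phi> n) = D n\<close> by (intro borel_measurable_lebesgueI borel_measurable_continuous_onI) simp
    qed
    have Lm: "L \<in> borel_measurable lebesgue"
      unfolding L_def by (intro borel_measurable_lebesgueI) measurable
    have "(\<lambda>n. LINT x|lebesgue. H x * D n x) \<longlonglongrightarrow> (LINT x|lebesgue. H x * L x)"
    proof (rule integral_dominated_convergence)
      show "integrable lebesgue (\<lambda>x. (1 + (q - p)) * \<bar>indicator {A..B} x * H x\<bar>)"
        using Hm by (intro integrable_mult_right integrable_abs)
      show "(\<lambda>x. H x * L x) \<in> borel_measurable lebesgue"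
        unfolding HL by (intro borel_measurable_times[OF borel_measurable_integrable[OF Hm] Lm])
      show "(\<lambda>x. H x * D n x) \<in> borel_measurable lebesgue" for n
        unfolding HD by (intro borel_measurable_times[OF borel_measurable_integrable[OF Hm] Dm])
      show "AE x in lebesgue. (\<lambda>n. H x * D n x) \<longlonglongrightarrow> H x * L x"
        by (intro AE_I2 tendsto_mult tendsto_const Dlim)
      show "AE x in lebesgue. norm (H x * D n x) \<le> (1 + (q - p)) * \<bar>indicator {A..B} x * H x\<bar>" for n
      proof (rule AE_I2)
        fix x
        show "norm (H x * D n x) \<le> (1 + (q - p)) * \<bar>indicator {A..B} x * H x\<bar>"
          unfolding HD real_norm_def abs_mult[of _ "D n x"] mult.commute[of _ "\<bar>D n x\<bar>"]
          by (rule mult_right_mono[OF Db]) simp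
      qed
    qed
    then have HL0: "(LINT x|lebesgue. H x * L x) = 0"
      unfolding zero using LIMSEQ_unique tendsto_const by blast
    have i: "integrable lebesgue (\<lambda>x. indicator {a<..b} x * H x)" for a b
    proof -
      have "set_integrable lebesgue {a<..b} H"
        by (rule set_integrable_subset[OF H[of a b]]) auto
      then show ?thesis by (simp add: set_integrable_def)
    qed
    have e: "(LINT x:{a<..b}|lebesgue. H x) = (LINT x:{a..b}|lebesgue. H x)" for a b
      unfolding set_lebesgue_integral_def real_scaleR_def
    proof (rule integral_cong_AE)
      show "(\<lambda>x. indicator {a..b} x * H x) \<in> borel_measurable lebesgue"
        using H[of a b] by (auto simp: set_integrable_def dest: borel_measurable_integrable)
      show "AE x in lebesgue. indicator {a<..b} x * H x = indicator {a..b} x * H x"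
        using AE_completion[OF AE_lborel_singleton[of a]] by eventually_elim (auto simp: indicator_def)
    qed (use i in auto)
    have "H x * L x = indicator {p<..q} x * H x - (q - p) * (indicator {0<..1} x * H x)" for x
      by (simp add: L_def algebra_simps)
    then have "(LINT x|lebesgue. H x * L x) = (LINT x:{p<..q}|lebesgue. H x) - (q - p) * (LINT x:{0<..1}|lebesgue. H x)"
      using i by (simp add: set_lebesgue_integral_def)
    then show ?thesis using HL0 e by (simp add: c_def mult.commute)
  qed
  have "AE x in lebesgue. H x - c = 0"
  proof (rule AE_zero_of_intervals)
    have c: "(\<lambda>x. c) absolutely_integrable_on {a..b}" for a b :: real
      by (intro absolutely_integrable_continuous_real continuous_intros)
    show "(\<lambda>x. H x - c) absolutely_integrable_on {a..b}" for a b
      using H c by (rule set_integral_diff(1))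
    fix a b :: real assume ab: "a \<le> b"
    have "(LINT x:{a..b}|lebesgue. H x) = c * (b - a)"
    proof (cases "a = b")
      case True
      have "negligible {b}" by simp
      then show ?thesis
        using True set_lebesgue_integral_eq_integral(2)[OF H[of b b]] by simp
    next
      case False
      then show ?thesis using key ab by simp
    qed
    moreover have "(LINT x:{a..b}|lebesgue. c) = c * (b - a)"
      using set_lebesgue_integral_eq_integral(2)[OF c[of a b]] ab by simp
    ultimately show "(LINT x:{a..b}|lebesgue. H x - c) = 0"
      using set_integral_diff(2)[OF H[of a b] c[of a b]] by simp
  qed
  then have "AE x in lebesgue. H x = c" by simp
  then show ?thesis by (rule that)
qed

section \<open>Absolutely continuous representatives of Sobolev functions\<close>

lemma L2_absolutely_integrable:
  assumes "u \<in> L2"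
  shows "u absolutely_integrable_on {a..b}"
proof -
  have u: "u \<in> borel_measurable lebesgue" "integrable lebesgue (\<lambda>x. (u x)\<^sup>2)"
    using assms by (auto simp: L2_def)
  have "(\<lambda>x::real. 1::real) absolutely_integrable_on {a..b}"
    by (intro absolutely_integrable_continuous_real continuous_intros)
  then have i: "integrable lebesgue (\<lambda>x. indicator {a..b} x + (u x)\<^sup>2)"
    using u by (auto simp: set_integrable_def)
  have "indicator {a..b} x * \<bar>u x\<bar> \<le> indicator {a..b} x + (u x)\<^sup>2" for x
  proof -
    have "0 \<le> (\<bar>u x\<bar> - 1)\<^sup>2" by simp
    then have "2 * \<bar>u x\<bar> \<le> (u x)\<^sup>2 + 1" by (simp add: power2_diff)
    then show ?thesis by (auto simp: indicator_def)
  qed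
  then show ?thesis
    unfolding set_integrable_def
    by (intro Bochner_Integration.integrable_bound[OF i] borel_measurable_scaleR borel_measurable_lebesgueI u AE_I2)
      (auto simp: abs_mult)
qed

lemma primitive_exists:
  fixes g :: "real \<Rightarrow> real"
  assumes g: "\<And>a b. g absolutely_integrable_on {a..b}"
  obtains G where "primitive_on UNIV G g"
proof -
  define G where "G x = (if 0 \<le> x then integral {0..x} g else - integral {x..0} g)" for x
  have i: "g integrable_on {a..b}" for a b
    using g by (rule set_lebesgue_integral_eq_integral(1))
  have "integral {a..b} g = G b - G a" if ab: "a \<le> b" for a b
  proof -
    consider "0 \<le> a" | "a < 0" "0 \<le> b" | "b < 0" using ab by linarith
    then show ?thesis
    proof cases
      case 1
      then show ?thesis
        using ab Henstock_Kurzweil_Integration.integral_combine[of 0 a b g] i by (simp add: G_def)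
    next
      case 2
      then show ?thesis
        using ab Henstock_Kurzweil_Integration.integral_combine[of a 0 b g] i by (simp add: G_def)
    next
      case 3
      then show ?thesis
        using ab Henstock_Kurzweil_Integration.integral_combine[of a b 0 g] i by (simp add: G_def)
    qed
  qed
  then have "primitive_on UNIV G g"
    using g i by (auto intro!: primitive_onI simp: has_integral_iff)
  then show ?thesis by (rule that)
qed

text \<open>For a primitive \<open>G\<close> of \<open>g\<close>, integration by parts against a
  test function shows that \<open>G\<close> has the same weak derivative as \<open>y\<close>. Hence
  \<open>y - G\<close> has weak derivative zero and is almost everywhere a constant, which is
  absorbed into \<open>Y\<close>.\<close>

lemma weak_deriv_primitive:
  assumes y: "y \<in> L2" and g: "g \<in> L2" and weak: "has_weak_deriv y g"
  obtains Y where "primitive_on UNIV Y g" "AE x in lebesgue. y x = Y x"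
proof -
  obtain G where G: "primitive_on UNIV G g"
    using primitive_exists[OF L2_absolutely_integrable[OF g]] .
  have cG: "continuous_on UNIV G" by (rule primitive_on_UNIV_continuous[OF G])
  have Gi: "G absolutely_integrable_on {a..b}" for a b
    by (intro absolutely_integrable_continuous_real continuous_on_subset[OF cG]) auto
  have Hi: "(\<lambda>x. y x - G x) absolutely_integrable_on {a..b}" for a b
    by (intro set_integral_diff(1) L2_absolutely_integrable y Gi)
  have "(LINT x|lebesgue. (y x - G x) * deriv \<phi> x) = 0" if \<phi>: "\<phi> \<in> test_functions" for \<phi>
  proof -
    obtain A B where AB: "A \<le> B" "\<And>x. x \<notin> {A..B} \<Longrightarrow> \<phi> x = 0" "\<And>x. x \<notin> {A..B} \<Longrightarrow> deriv \<phi> x = 0"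
      and d: "\<And>x. (\<phi> has_real_derivative deriv \<phi> x) (at x)"
      and c: "continuous_on UNIV \<phi>" "continuous_on UNIV (deriv \<phi>)"
      using test_functionsE[OF \<phi>] by metis
    have p: "primitive_on UNIV (\<lambda>x. G x * \<phi> x) (\<lambda>x. g x * \<phi> x + G x * deriv \<phi> x)"
      by (rule primitive_on_mult[OF G primitive_on_deriv[OF d c(2)]])
    have i1: "integrable lebesgue (\<lambda>x. g x * \<phi> x)"
      by (rule integrable_compact_mult[OF L2_absolutely_integrable[OF g] c(1) AB(2)])
    have i2: "integrable lebesgue (\<lambda>x. G x * deriv \<phi> x)"
      by (rule integrable_compact_mult[OF Gi c(2) AB(3)])
    have i3: "integrable lebesgue (\<lambda>x. y x * deriv \<phi> x)"
      by (rule integrable_compact_mult[OF L2_absolutely_integrable[OF y] c(2) AB(3)])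
    have i4: "integrable lebesgue (\<lambda>x. G x * \<phi> x)"
      by (rule integrable_compact_mult[OF Gi c(1) AB(2)])
    have "(LINT x|lebesgue. g x * \<phi> x + G x * deriv \<phi> x) = 0"
      by (rule primitive_on_integral_UNIV[OF p Bochner_Integration.integrable_add[OF i1 i2] i4])
    then have "(LINT x|lebesgue. g x * \<phi> x) + (LINT x|lebesgue. G x * deriv \<phi> x) = 0"
      using i1 i2 by simp
    moreover have "(LINT x|lebesgue. y x * deriv \<phi> x) = - (LINT x|lebesgue. g x * \<phi> x)"
      using weak \<phi> by (simp add: has_weak_deriv_def)
    ultimately show ?thesis
      using i2 i3 by (simp add: left_diff_distrib)
  qed
  then obtain c where c: "AE x in lebesgue. y x - G x = c"
    using du_Bois_Reymond[OF Hi] by blast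
  show ?thesis
  proof (rule that)
    show "primitive_on UNIV (\<lambda>x. G x + c) g"
      using G by (auto simp: primitive_on_def)
    show "AE x in lebesgue. y x = G x + c"
      using c by eventually_elim simp
  qed
qed

section \<open>The two lowest eigenfunctions and coercivity\<close>

definition gauss :: "real \<Rightarrow> real" where
  "gauss x = exp (- (x\<^sup>2 / 4))"

lemma gauss_pos [simp]: "0 < gauss x" and gauss_nonneg [simp]: "0 \<le> gauss x" and gauss_le_1: "gauss x \<le> 1"
  by (simp_all add: gauss_def)

lemma gauss_deriv [derivative_intros]:
  "(gauss has_real_derivative - (x / 2) * gauss x) (at x)"
  unfolding gauss_def by (auto intro!: derivative_eq_intros)

lemma continuous_on_gauss [continuous_intros]: "continuous_on S gauss"
  unfolding gauss_def by (intro continuous_intros) auto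

text \<open>Fourth power of \<open>1 + t \<le> exp t\<close> at \<open>t = x^2 / 16\<close>. Four
  powers are taken so that three remain for integrands after one is spent on the integrable factor
  \<open>1 / (1 + x^2)\<close>.\<close>

lemma gauss_decay: "(1 + x\<^sup>2) ^ 4 * gauss x \<le> 16 ^ 4"
proof -
  have "(1 + x\<^sup>2) / 16 \<le> exp (x\<^sup>2 / 16)"
    using exp_ge_add_one_self[of "x\<^sup>2 / 16"] unfolding add_divide_distrib by linarith
  then have "((1 + x\<^sup>2) / 16) ^ 4 \<le> exp (x\<^sup>2 / 16) ^ 4"
    by (intro power_mono) auto
  also have "\<dots> = exp (x\<^sup>2 / 4)" by (simp add: exp_of_nat_mult[symmetric])
  finally have "(1 + x\<^sup>2) ^ 4 \<le> 16 ^ 4 * exp (x\<^sup>2 / 4)"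
    by (simp add: power_divide)
  then show ?thesis by (simp add: gauss_def exp_minus field_simps)
qed

lemma integrable_inverse_square: "integrable lebesgue (\<lambda>x::real. 1 / (1 + x\<^sup>2))"
proof -
  have "integrable lborel (\<lambda>x::real. inverse (1 + x^2))"
    using integrable_inverse_1_plus_square by (simp add: set_integrable_def)
  then show ?thesis
    by (simp add: integrable_completion inverse_eq_divide)
qed

lemma integrable_gauss_bound:
  assumes f: "continuous_on UNIV f" and b: "\<And>x. \<bar>f x\<bar> \<le> K * ((1 + x\<^sup>2) ^ 3 * gauss x)"
  shows "integrable lebesgue (f :: real \<Rightarrow> real)"
proof (rule Bochner_Integration.integrable_bound)
  show "integrable lebesgue (\<lambda>x::real. K * 16 ^ 4 * (1 / (1 + x\<^sup>2)))"
    by (intro integrable_mult_right integrable_inverse_square)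
  show "f \<in> borel_measurable lebesgue"
    using f by (intro borel_measurable_lebesgueI borel_measurable_continuous_onI)
  have K: "0 \<le> K" using b[of 0] by (auto simp: gauss_def)
  have "\<bar>f x\<bar> \<le> K * 16 ^ 4 * (1 / (1 + x\<^sup>2))" for x
  proof -
    have "0 < 1 + x\<^sup>2" by (simp add: add_pos_nonneg)
    then have "(1 + x\<^sup>2) ^ 3 * gauss x \<le> 16 ^ 4 * (1 / (1 + x\<^sup>2))"
      using gauss_decay[of x] by (simp add: field_simps power3_eq_cube power4_eq_xxxx)
    from mult_left_mono[OF this K] b[of x] show ?thesis by simp
  qed
  then show "AE x in lebesgue. norm (f x) \<le> norm (K * 16 ^ 4 * (1 / (1 + x\<^sup>2)))"
    using K by (intro AE_I2) (auto intro: order_trans[OF _ abs_ge_self])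
qed

lemma gauss_square_le: "(gauss x)\<^sup>2 \<le> gauss x"
  using gauss_le_1[of x] gauss_pos[of x] by (simp add: power2_eq_square mult_left_le)

lemma poly_gauss_bound:
  assumes "0 \<le> p" "p \<le> (1 + x\<^sup>2) ^ 3"
  shows "\<bar>p * (gauss x)\<^sup>2\<bar> \<le> 1 * ((1 + x\<^sup>2) ^ 3 * gauss x)"
  using mult_mono[OF assms(2) gauss_square_le[of x]] assms by (simp add: abs_mult)

lemma power_weight_mono: "m \<le> 3 \<Longrightarrow> (1 + x\<^sup>2) ^ m \<le> (1 + x\<^sup>2 :: real) ^ 3"
  by (intro power_increasing) auto

lemma form_domain_gauss: "form_domain gauss (\<lambda>x. - (x / 2) * gauss x)"
proof -
  have c: "continuous_on UNIV (\<lambda>x. - (x / 2) * gauss x)" by (intro continuous_intros) auto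
  have "integrable lebesgue (\<lambda>x. (- (x / 2) * gauss x)\<^sup>2)"
  proof (rule integrable_gauss_bound)
    fix x :: real
    have "(x / 2)\<^sup>2 \<le> 1 + x\<^sup>2" using zero_le_power2[of x] unfolding power_divide by simp
    also have "\<dots> \<le> (1 + x\<^sup>2) ^ 3" using power_weight_mono[of 1 x] by simp
    finally have le: "(x / 2)\<^sup>2 \<le> (1 + x\<^sup>2) ^ 3" .
    have eq: "(- (x / 2) * gauss x)\<^sup>2 = (x / 2)\<^sup>2 * (gauss x)\<^sup>2"
      by (simp add: power2_eq_square)
    show "\<bar>(- (x / 2) * gauss x)\<^sup>2\<bar> \<le> 1 * ((1 + x\<^sup>2) ^ 3 * gauss x)"
      unfolding eq by (rule poly_gauss_bound[OF zero_le_power2 le])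
  qed (intro continuous_intros; simp)
  moreover have "integrable lebesgue (\<lambda>x. (1 + x\<^sup>2) * (gauss x)\<^sup>2)"
    using poly_gauss_bound[of "1 + x\<^sup>2" x for x] power_weight_mono[of 1]
    by (intro integrable_gauss_bound[where K = 1] continuous_intros) auto
  ultimately show ?thesis
    unfolding form_domain_def using c
    by (intro conjI primitive_on_deriv gauss_deriv borel_measurable_lebesgueI borel_measurable_continuous_onI)
qed

lemma form_domain_x_gauss: "form_domain (\<lambda>x. x * gauss x) (\<lambda>x. (1 - x\<^sup>2 / 2) * gauss x)"
proof -
  have c: "continuous_on UNIV (\<lambda>x. (1 - x\<^sup>2 / 2) * gauss x)" by (intro continuous_intros) auto
  have "((\<lambda>x. x * gauss x) has_real_derivative (1 - x\<^sup>2 / 2) * gauss x) (at x)" for x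
    by (rule DERIV_cong[OF DERIV_mult[OF DERIV_ident gauss_deriv]]) (simp add: algebra_simps power2_eq_square)
  moreover have "integrable lebesgue (\<lambda>x. ((1 - x\<^sup>2 / 2) * gauss x)\<^sup>2)"
  proof (rule integrable_gauss_bound)
    fix x :: real
    have "\<bar>1 - x\<^sup>2 / 2\<bar> \<le> 1 + x\<^sup>2" using zero_le_power2[of x] unfolding abs_le_iff by linarith
    then have "(1 - x\<^sup>2 / 2)\<^sup>2 \<le> (1 + x\<^sup>2)\<^sup>2" using power_mono[of "\<bar>1 - x\<^sup>2 / 2\<bar>" _ 2] by simp
    then show "\<bar>((1 - x\<^sup>2 / 2) * gauss x)\<^sup>2\<bar> \<le> 1 * ((1 + x\<^sup>2) ^ 3 * gauss x)"
      using poly_gauss_bound[of "(1 - x\<^sup>2 / 2)\<^sup>2" x] power_weight_mono[of 2 x] by (simp add: power_mult_distrib)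
  qed (intro continuous_intros; simp)
  moreover have "integrable lebesgue (\<lambda>x. (1 + x\<^sup>2) * (x * gauss x)\<^sup>2)"
  proof (rule integrable_gauss_bound)
    fix x :: real
    have "(1 + x\<^sup>2) * x\<^sup>2 \<le> (1 + x\<^sup>2)\<^sup>2" by (simp add: power2_eq_square[of "1 + x\<^sup>2"] mult_left_mono)
    then show "\<bar>(1 + x\<^sup>2) * (x * gauss x)\<^sup>2\<bar> \<le> 1 * ((1 + x\<^sup>2) ^ 3 * gauss x)"
      using poly_gauss_bound[of "(1 + x\<^sup>2) * x\<^sup>2" x] power_weight_mono[of 2 x]
      by (simp add: power_mult_distrib mult.assoc)
  qed (intro continuous_intros)
  ultimately show ?thesis
    unfolding form_domain_def using c
    by (intro conjI primitive_on_deriv borel_measurable_lebesgueI borel_measurable_continuous_onI)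
qed

lemma integral_gauss_square_pos: "0 < (LINT x|lebesgue. (gauss x)\<^sup>2)"
proof -
  have "(LINT x|lebesgue. (gauss x)\<^sup>2) \<noteq> 0"
  proof
    assume "(LINT x|lebesgue. (gauss x)\<^sup>2) = 0"
    then have "AE x in lebesgue. (gauss x)\<^sup>2 = 0"
      using integral_nonneg_eq_0_iff_AE[OF form_domainD(6)[OF form_domain_gauss]] by simp
    then have "AE x in lebesgue. x \<notin> {0..1::real}"
      by eventually_elim (metis gauss_pos less_irrefl zero_eq_power2)
    then have "{0..1::real} \<in> null_sets lebesgue"
      by (subst AE_iff_null_sets) auto
    then show False by (auto dest: null_setsD1)
  qed
  moreover have "0 \<le> (LINT x|lebesgue. (gauss x)\<^sup>2)" by simp
  ultimately show ?thesis by linarith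
qed

lemma integral_x_gauss_square: "(LINT x|lebesgue. gauss x * (x * gauss x)) = 0"
proof -
  have "(LINT x|lebesgue. gauss x * (x * gauss x)) = (LINT x|lebesgue. gauss (- x) * (- x * gauss (- x)))"
    by (rule lebesgue_integral_reflect[symmetric])
  also have "\<dots> = - (LINT x|lebesgue. gauss x * (x * gauss x))"
    by (simp add: gauss_def)
  finally show ?thesis by simp
qed

text \<open>One parameter covers both quantities of the theorem: \<open>l = 3/2\<close> gives the
  quadratic form of \<open>L\<close>, and \<open>l = -1/2\<close> the square of the norm.\<close>

definition energy :: "real \<Rightarrow> (real \<Rightarrow> real) \<Rightarrow> (real \<Rightarrow> real) \<Rightarrow> real" where
  "energy l W w = (LINT x|lebesgue. (w x)\<^sup>2 + (x\<^sup>2 / 4 - l) * (W x)\<^sup>2)"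

lemma energy_shift:
  assumes "form_domain W w"
  shows "energy l W w = energy k W w + (k - l) * (LINT x|lebesgue. (W x)\<^sup>2)"
proof -
  have "energy l W w = (LINT x|lebesgue. ((w x)\<^sup>2 + (x\<^sup>2 / 4 - k) * (W x)\<^sup>2) + (k - l) * (W x)\<^sup>2)"
    unfolding energy_def by (intro Bochner_Integration.integral_cong) (auto simp: algebra_simps)
  then show ?thesis
    using form_domain_energy_integrable[OF assms, of k] form_domainD(6)[OF assms]
    by (simp add: energy_def)
qed

lemma form_domain_mult_integrable:
  assumes "form_domain U u" "form_domain W w"
  shows "integrable lebesgue (\<lambda>x. U x * W x)" "integrable lebesgue (\<lambda>x. U x * w x)"
  using form_domainD[OF assms(1)] form_domainD[OF assms(2)]
  by (auto intro: square_integrable_mult)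

text \<open>
  \<open>gauss\<close> and \<open>x gauss\<close> are the eigenfunctions of \<open>L\<close> for the eigenvalues \<open>-1\<close> and \<open>0\<close>;
  the cross terms integrate to zero because they form the total derivative of \<open>(2 Y + H) h\<close>.
\<close>

lemma energy_perturb:
  assumes Y: "form_domain Y y" and orth: "(LINT x|lebesgue. gauss x * Y x) = 0"
  shows "energy (3 / 2) (\<lambda>x. Y x + (\<alpha> * gauss x + \<beta> * (x * gauss x)))
      (\<lambda>x. y x + (\<alpha> * (- (x / 2) * gauss x) + \<beta> * ((1 - x\<^sup>2 / 2) * gauss x)))
    = energy (3 / 2) Y y - \<alpha>\<^sup>2 * (LINT x|lebesgue. (gauss x)\<^sup>2)"
proof -
  define H where "H x = \<alpha> * gauss x + \<beta> * (x * gauss x)" for x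
  define h where "h x = \<alpha> * (- (x / 2) * gauss x) + \<beta> * ((1 - x\<^sup>2 / 2) * gauss x)" for x
  \<comment> \<open>The second derivative of \<open>H\<close> as dictated by the eigenvalue
    equations, that is, \<open>L H = - \<alpha> gauss\<close>.\<close>
  define h' where "h' x = (x\<^sup>2 / 4 - 3 / 2) * H x + \<alpha> * gauss x" for x
  have Hd: "form_domain H h"
    unfolding H_def h_def by (intro form_domain_add form_domain_cmult form_domain_gauss form_domain_x_gauss)
  have dh: "(h has_real_derivative h' x) (at x)" for x
    unfolding h_def h'_def H_def
    by (auto intro!: derivative_eq_intros gauss_deriv simp: algebra_simps power2_eq_square diff_divide_distrib add_divide_distrib)
  have "continuous_on UNIV h'"
    unfolding h'_def H_def by (intro continuous_intros) auto
  from primitive_on_deriv[OF dh this] have ph: "primitive_on UNIV h h'" by simp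
  have Z: "form_domain (\<lambda>x. 2 * Y x + H x) (\<lambda>x. 2 * y x + h x)"
    by (intro form_domain_add form_domain_cmult Y Hd)
  let ?F = "\<lambda>x. (2 * Y x + H x) * h x"
  let ?f = "\<lambda>x. (2 * y x + h x) * h x + (2 * Y x + H x) * h' x"
  have p: "primitive_on UNIV ?F ?f"
    by (rule primitive_on_mult[OF form_domainD(1)[OF Z] ph])
  have iF: "integrable lebesgue ?F"
    by (rule form_domain_mult_integrable(2)[OF Z Hd])
  let ?q = "\<lambda>W w x. (w x)\<^sup>2 + (x\<^sup>2 / 4 - 3 / 2) * (W x)\<^sup>2"
  have YH: "form_domain (\<lambda>x. Y x + H x) (\<lambda>x. y x + h x)" by (intro form_domain_add Y Hd)
  \<comment> \<open>The differences of squares factor as \<open>(2 y + h) h\<close> and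
    \<open>(2 Y + H) H\<close>; replacing the potential times \<open>H\<close> by
    \<open>h' - \<alpha> gauss\<close> exposes the total derivative.\<close>
  have eq: "?f x = ?q (\<lambda>x. Y x + H x) (\<lambda>x. y x + h x) x - ?q Y y x + \<alpha> * (gauss x * (2 * Y x + H x))" for x
    unfolding h'_def by (simp add: power2_eq_square algebra_simps diff_divide_distrib add_divide_distrib)
  have iq: "integrable lebesgue (?q (\<lambda>x. Y x + H x) (\<lambda>x. y x + h x))" "integrable lebesgue (?q Y y)"
    by (intro form_domain_energy_integrable YH Y)+
  have ig: "integrable lebesgue (\<lambda>x. gauss x * (2 * Y x + H x))"
    by (rule form_domain_mult_integrable(1)[OF form_domain_gauss Z])
  have "(LINT x|lebesgue. ?f x) = 0"
  proof (rule primitive_on_integral_UNIV[OF p _ iF])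
    show "integrable lebesgue ?f"
      unfolding eq by (intro Bochner_Integration.integrable_add Bochner_Integration.integrable_diff integrable_mult_right iq ig)
  qed
  also have "(LINT x|lebesgue. ?f x) = (LINT x|lebesgue. ?q (\<lambda>x. Y x + H x) (\<lambda>x. y x + h x) x)
      - (LINT x|lebesgue. ?q Y y x) + \<alpha> * (LINT x|lebesgue. gauss x * (2 * Y x + H x))"
    unfolding eq using iq ig by simp
  also have "(LINT x|lebesgue. gauss x * (2 * Y x + H x)) =
      (LINT x|lebesgue. 2 * (gauss x * Y x) + (\<alpha> * (gauss x)\<^sup>2 + \<beta> * (gauss x * (x * gauss x))))"
    by (intro Bochner_Integration.integral_cong) (auto simp: H_def algebra_simps power2_eq_square)
  also have "\<dots> = \<alpha> * (LINT x|lebesgue. (gauss x)\<^sup>2)"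
    using form_domain_mult_integrable(1)[OF form_domain_gauss Y]
      form_domain_mult_integrable(1)[OF form_domain_gauss form_domain_x_gauss]
      form_domainD(6)[OF form_domain_gauss] orth integral_x_gauss_square
    by simp
  finally show ?thesis
    by (simp add: energy_def H_def h_def power2_eq_square)
qed

section \<open>The constraint function, an antiderivative of the Gaussian\<close>

lemma u0_eq: "u0 x = (2 * pi) powr (- 1 / 4) * gauss x"
  by (simp add: u0_def gauss_def)

lemma integrable_gauss: "integrable lebesgue gauss"
proof (rule integrable_gauss_bound[of _ 1])
  have "1 * gauss x \<le> (1 + x\<^sup>2) ^ 3 * gauss x" for x
    using power_weight_mono[of 0 x] gauss_pos[of x] by (intro mult_right_mono) auto
  then show "\<bar>gauss x\<bar> \<le> 1 * ((1 + x\<^sup>2) ^ 3 * gauss x)" for x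
    using gauss_pos[of x] by simp
qed (intro continuous_intros)

lemma antideriv_u0_primitive: "primitive_on UNIV (antideriv u0) u0"
  and antideriv_u0_bounds: "0 \<le> antideriv u0 x" "antideriv u0 x \<le> (LINT x|lebesgue. u0 x)"
proof -
  have u0_eq': "u0 = (\<lambda>x. (2 * pi) powr (- 1 / 4) * gauss x)" by (auto simp: u0_eq)
  have i: "integrable lebesgue u0"
    unfolding u0_eq' by (intro integrable_mult_right integrable_gauss)
  have nn: "0 \<le> u0 x" for x by (simp add: u0_eq)
  have si: "set_integrable lebesgue A u0" if "A \<in> sets borel" for A
    by (rule set_integrable_lebesgue_subset[OF i that])
  show "primitive_on UNIV (antideriv u0) u0"
  proof (rule primitive_onI)
    fix a b :: real assume ab: "a \<le> b"
    show ai: "u0 absolutely_integrable_on {a..b}" by (rule si) simp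
    have "(LINT x:{a..b}|lebesgue. u0 x) = antideriv u0 b - antideriv u0 a"
    proof -
      have "antideriv u0 b = (LINT x|lebesgue. indicator {..a} x * u0 x + indicator {a..b} x * u0 x)"
        unfolding antideriv_def set_lebesgue_integral_def
      proof (rule integral_cong_AE)
        show "AE x in lebesgue. indicat_real {..b} x *\<^sub>R u0 x = indicator {..a} x * u0 x + indicator {a..b} x * u0 x"
          using AE_completion[OF AE_lborel_singleton[of a]] by eventually_elim (use ab in \<open>auto simp: indicator_def\<close>)
      qed (use si[unfolded set_integrable_def, THEN borel_measurable_integrable] in auto)
      also have "\<dots> = antideriv u0 a + (LINT x:{a..b}|lebesgue. u0 x)"
        using si[of "{..a}"] si[of "{a..b}"]
        by (simp add: antideriv_def set_lebesgue_integral_def set_integrable_def)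
      finally show ?thesis by simp
    qed
    then show "(u0 has_integral antideriv u0 b - antideriv u0 a) {a..b}"
      using has_integral_set_lebesgue[OF ai] by simp
  qed
  show "0 \<le> antideriv u0 x"
    unfolding antideriv_def set_lebesgue_integral_def using nn by simp
  show "antideriv u0 x \<le> (LINT x|lebesgue. u0 x)"
    unfolding antideriv_def set_lebesgue_integral_def
    using si[of "{..x}"] i nn by (intro integral_mono) (auto simp: set_integrable_def indicator_def)
qed

text \<open>Integration by parts: \<open>x gauss\<close> is the derivative of
  \<open>- 2 gauss\<close>, and the derivative of \<open>antideriv u0\<close> is a positive multiple
  of \<open>gauss\<close>. The pairing is therefore a positive multiple of the integral of
  \<open>gauss^2\<close>.\<close>

lemma antideriv_u0_x_gauss:
  "0 < (LINT x|lebesgue. antideriv u0 x * (x * gauss x))"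
proof -
  let ?v = "antideriv u0" and ?\<kappa> = "(2 * pi) powr (- 1 / 4) :: real"
  note v = antideriv_u0_primitive antideriv_u0_bounds
  have cv: "continuous_on UNIV ?v" by (rule primitive_on_UNIV_continuous[OF v(1)])
  have p: "primitive_on UNIV (\<lambda>x. ?v x * (- 2 * gauss x)) (\<lambda>x. u0 x * (- 2 * gauss x) + ?v x * (- 2 * (- (x / 2) * gauss x)))"
    by (intro primitive_on_mult v primitive_on_cmult form_domainD(1)[OF form_domain_gauss])
  let ?V = "LINT x|lebesgue. u0 x"
  have bound: "\<bar>?v x\<bar> \<le> ?V" for x using v(2,3)[of x] by simp
  have V: "0 \<le> ?V" using bound[of 0] by linarith
  have iv: "integrable lebesgue (\<lambda>x. ?v x * f x)" if f: "continuous_on UNIV f" "\<And>x. \<bar>f x\<bar> \<le> 2 * ((1 + x\<^sup>2) ^ 3 * gauss x)" for f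
  proof (rule integrable_gauss_bound)
    show "\<bar>?v x * f x\<bar> \<le> (?V * 2) * ((1 + x\<^sup>2) ^ 3 * gauss x)" for x
      using mult_mono[OF bound f(2), of x x] V by (simp add: abs_mult mult.assoc)
  qed (intro continuous_intros cv f(1))
  have w: "1 \<le> (1 + x\<^sup>2) ^ 3" "\<bar>x\<bar> \<le> (1 + x\<^sup>2) ^ 3" for x :: real
  proof -
    show "1 \<le> (1 + x\<^sup>2) ^ 3" using power_weight_mono[of 0 x] by simp
    have "0 \<le> (\<bar>x\<bar> - 1)\<^sup>2" by simp
    then have "2 * \<bar>x\<bar> \<le> x\<^sup>2 + 1" by (simp add: power2_diff)
    then show "\<bar>x\<bar> \<le> (1 + x\<^sup>2) ^ 3" using power_weight_mono[of 1 x] by simp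
  qed
  have i1: "integrable lebesgue (\<lambda>x. ?v x * (- 2 * gauss x))"
    using mult_right_mono[OF w(1) gauss_nonneg] by (intro iv continuous_intros) (simp add: abs_mult)
  have "\<bar>x * gauss x\<bar> \<le> 2 * ((1 + x\<^sup>2) ^ 3 * gauss x)" for x
  proof -
    have "\<bar>x * gauss x\<bar> \<le> (1 + x\<^sup>2) ^ 3 * gauss x"
      using mult_right_mono[OF w(2) gauss_nonneg] by (simp add: abs_mult)
    moreover have "0 \<le> (1 + x\<^sup>2) ^ 3 * gauss x" by simp
    ultimately show ?thesis by linarith
  qed
  then have i2: "integrable lebesgue (\<lambda>x. ?v x * (x * gauss x))"
    by (intro iv continuous_intros)
  have i3: "integrable lebesgue (\<lambda>x. (gauss x)\<^sup>2)" by (rule form_domainD(6)[OF form_domain_gauss])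
  have eq: "u0 x * (- 2 * gauss x) + ?v x * (- 2 * (- (x / 2) * gauss x)) = ?v x * (x * gauss x) - 2 * ?\<kappa> * (gauss x)\<^sup>2" for x
    by (simp add: u0_eq power2_eq_square)
  have "(LINT x|lebesgue. ?v x * (x * gauss x) - 2 * ?\<kappa> * (gauss x)\<^sup>2) = 0"
    using primitive_on_integral_UNIV[OF p _ i1] i2 i3 unfolding eq by simp
  then have "(LINT x|lebesgue. ?v x * (x * gauss x)) = 2 * ?\<kappa> * (LINT x|lebesgue. (gauss x)\<^sup>2)"
    using i2 i3 by simp
  moreover have "0 < ?\<kappa>" by simp
  ultimately show ?thesis using integral_gauss_square_pos by simp
qed

text \<open>\<open>antideriv u0\<close> is bounded without being square integrable, but it becomes
  so after division by \<open>sqrt (1 + x^2)\<close>. The weight in the \<open>L2_1\<close>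
  condition compensates for this division.\<close>

lemma antideriv_u0_Cauchy_Schwarz:
  obtains D where "0 < D"
    "\<And>W w. form_domain W w \<Longrightarrow> integrable lebesgue (\<lambda>x. antideriv u0 x * W x)"
    "\<And>W w. form_domain W w \<Longrightarrow>
      (LINT x|lebesgue. antideriv u0 x * W x)\<^sup>2 \<le> D * (LINT x|lebesgue. (1 + x\<^sup>2) * (W x)\<^sup>2)"
proof -
  let ?v = "antideriv u0"
  define V where "V = (LINT x|lebesgue. u0 x)"
  have v: "\<bar>?v x\<bar> \<le> V" for x using antideriv_u0_bounds[of x] by (simp add: V_def)
  have v2: "(?v x)\<^sup>2 \<le> V\<^sup>2" for x using power_mono[OF v[of x], of 2] by simp
  have mv: "?v \<in> borel_measurable lebesgue"
    by (intro borel_measurable_lebesgueI borel_measurable_continuous_onI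
        primitive_on_UNIV_continuous[OF antideriv_u0_primitive])
  \<comment> \<open>The summand 1 guarantees positivity, so that division by \<open>D\<close> is
    safe below.\<close>
  define D where "D = V\<^sup>2 * (LINT x|lebesgue. 1 / (1 + x\<^sup>2)) + 1"
  have D: "0 < D"
    unfolding D_def by (intro add_nonneg_pos mult_nonneg_nonneg integral_nonneg_AE AE_I2) auto
  have key: "2 * s * (?v x * W) \<le> s\<^sup>2 * (V\<^sup>2 * (1 / (1 + x\<^sup>2))) + (1 + x\<^sup>2) * W\<^sup>2" for s x W
  proof -
    have p: "0 < 1 + x\<^sup>2" by (simp add: add_pos_nonneg)
    have "0 \<le> (s * ?v x - (1 + x\<^sup>2) * W)\<^sup>2 / (1 + x\<^sup>2)" using p by simp
    also have "\<dots> = s\<^sup>2 * ((?v x)\<^sup>2 * (1 / (1 + x\<^sup>2))) - 2 * s * (?v x * W) + (1 + x\<^sup>2) * W\<^sup>2"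
      unfolding power2_diff power_mult_distrib using p by (simp add: field_simps power2_eq_square[of "1 + x\<^sup>2"])
    also have "s\<^sup>2 * ((?v x)\<^sup>2 * (1 / (1 + x\<^sup>2))) \<le> s\<^sup>2 * (V\<^sup>2 * (1 / (1 + x\<^sup>2)))"
      using v2 p by (intro mult_left_mono mult_right_mono) auto
    finally show ?thesis by linarith
  qed
  have int: "integrable lebesgue (\<lambda>x. ?v x * W x)" if W: "form_domain W w" for W w
  proof (rule Bochner_Integration.integrable_bound)
    show "integrable lebesgue (\<lambda>x. V\<^sup>2 * (1 / (1 + x\<^sup>2)) + (1 + x\<^sup>2) * (W x)\<^sup>2)"
      by (intro Bochner_Integration.integrable_add integrable_mult_right integrable_inverse_square form_domainD(5)[OF W])
    show "(\<lambda>x. ?v x * W x) \<in> borel_measurable lebesgue"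
      by (intro borel_measurable_times mv form_domainD(3)[OF W])
    have "\<bar>?v x * W x\<bar> \<le> V\<^sup>2 * (1 / (1 + x\<^sup>2)) + (1 + x\<^sup>2) * (W x)\<^sup>2" for x
      using key[of 1 x "W x"] key[of "-1" x "W x"] by (simp add: abs_le_iff) 
    then show "AE x in lebesgue. norm (?v x * W x) \<le> norm (V\<^sup>2 * (1 / (1 + x\<^sup>2)) + (1 + x\<^sup>2) * (W x)\<^sup>2)"
      by (intro AE_I2) (auto intro: order_trans[OF _ abs_ge_self])
  qed
  have "(LINT x|lebesgue. ?v x * W x)\<^sup>2 \<le> D * (LINT x|lebesgue. (1 + x\<^sup>2) * (W x)\<^sup>2)" if W: "form_domain W w" for W w
  proof -
    let ?b = "LINT x|lebesgue. ?v x * W x" and ?c = "LINT x|lebesgue. (1 + x\<^sup>2) * (W x)\<^sup>2"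
    \<comment> \<open>The optimal parameter in \<open>2 s b \<le> s^2 D + c\<close>, which then
      reads \<open>b^2 / D \<le> c\<close>.\<close>
    define s where "s = ?b / D"
    have "(LINT x|lebesgue. 2 * s * (?v x * W x)) \<le> (LINT x|lebesgue. s\<^sup>2 * (V\<^sup>2 * (1 / (1 + x\<^sup>2))) + (1 + x\<^sup>2) * (W x)\<^sup>2)"
      using int[OF W] form_domainD(5)[OF W] integrable_inverse_square key
      by (intro integral_mono Bochner_Integration.integrable_add integrable_mult_right)
    also have "\<dots> = s\<^sup>2 * (V\<^sup>2 * (LINT x|lebesgue. 1 / (1 + x\<^sup>2))) + ?c"
      by (simp only: Bochner_Integration.integral_add[OF integrable_mult_right[OF integrable_mult_right[OF
            integrable_inverse_square]] form_domainD(5)[OF W]] integral_mult_right_zero)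
    also have "\<dots> \<le> s\<^sup>2 * D + ?c"
      by (intro add_right_mono mult_left_mono) (simp_all add: D_def)
    finally have "2 * s * ?b \<le> s\<^sup>2 * D + ?c"
      using int[OF W] by simp
    then show ?thesis
      using D by (simp add: s_def power2_eq_square field_simps)
  qed
  with D int show ?thesis by (rule that)
qed

section \<open>Comparison of the norm with the quadratic form\<close>

lemma energy_norm_add:
  assumes U: "form_domain U u" and W: "form_domain W w"
  shows "energy (- 1 / 2) (\<lambda>x. U x + W x) (\<lambda>x. u x + w x)
    \<le> 2 * energy (- 1 / 2) U u + 2 * energy (- 1 / 2) W w"
proof -
  let ?q = "\<lambda>W w x. (w x)\<^sup>2 + (x\<^sup>2 / 4 - (- 1 / 2)) * (W x)\<^sup>2"
  have p: "(p + q)\<^sup>2 \<le> 2 * p\<^sup>2 + 2 * q\<^sup>2" for p q :: real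
    using sum_squares_bound[of p q] by (simp add: power2_sum)
  note i = form_domain_energy_integrable[OF U, of "- 1 / 2"] form_domain_energy_integrable[OF W, of "- 1 / 2"]
  have "(LINT x|lebesgue. ?q (\<lambda>x. U x + W x) (\<lambda>x. u x + w x) x)
      \<le> (LINT x|lebesgue. 2 * ?q U u x + 2 * ?q W w x)"
  proof (rule integral_mono[OF form_domain_energy_integrable[OF form_domain_add[OF U W]]
        Bochner_Integration.integrable_add[OF integrable_mult_right[OF i(1)] integrable_mult_right[OF i(2)]]])
    fix x :: real
    have "(x\<^sup>2 / 4 - (- 1 / 2)) * (U x + W x)\<^sup>2 \<le> (x\<^sup>2 / 4 - (- 1 / 2)) * (2 * (U x)\<^sup>2 + 2 * (W x)\<^sup>2)"
      by (intro mult_left_mono p) simp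
    with p[of "u x" "w x"]
    show "?q (\<lambda>x. U x + W x) (\<lambda>x. u x + w x) x \<le> 2 * ?q U u x + 2 * ?q W w x"
      by (simp add: algebra_simps)
  qed
  then show ?thesis
    using i unfolding energy_def
    by (subst (asm) Bochner_Integration.integral_add) (simp_all only: integrable_mult_right integral_mult_right_zero)
qed

lemma energy_cmult: "energy l (\<lambda>x. c * W x) (\<lambda>x. c * w x) = c\<^sup>2 * energy l W w"
  unfolding energy_def
  by (subst Bochner_Integration.integral_mult_right_zero[symmetric])
    (auto intro!: Bochner_Integration.integral_cong simp: algebra_simps power2_eq_square)

lemma energy_norm_nonneg: "0 \<le> energy (- 1 / 2) W w"
  unfolding energy_def by (intro integral_nonneg_AE AE_I2) (simp add: add_nonneg_nonneg)

text \<open>The factor 4 undoes the coefficient of \<open>x^2\<close>: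
  \<open>4 (x^2 / 4 + 1 / 2) = x^2 + 2\<close>.\<close>

lemma weight_le_energy_norm:
  assumes W: "form_domain W w"
  shows "(LINT x|lebesgue. (1 + x\<^sup>2) * (W x)\<^sup>2) \<le> 4 * energy (- 1 / 2) W w"
proof -
  have "(LINT x|lebesgue. (1 + x\<^sup>2) * (W x)\<^sup>2)
      \<le> (LINT x|lebesgue. 4 * ((w x)\<^sup>2 + (x\<^sup>2 / 4 - (- 1 / 2)) * (W x)\<^sup>2))"
    by (rule integral_mono[OF form_domainD(5)[OF W] integrable_mult_right[OF form_domain_energy_integrable[OF W]]])
      (simp add: algebra_simps)
  then show ?thesis by (simp only: energy_def integral_mult_right_zero)
qed

text \<open>\<open>W2\<close> is \<open>Y\<close> moved along the kernel of \<open>L\<close>, so it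
  keeps the energy of \<open>Y\<close> while its norm is controlled through the zeros of
  \<open>W\<close>. The constraint on \<open>antideriv u0\<close> bounds the size of this move by
  the norm of \<open>W2\<close>, which transfers the control back to \<open>Y\<close>.\<close>

lemma energy_coercive:
  obtains K where "1 < K"
    "\<And>Y y. form_domain Y y \<Longrightarrow> (LINT x|lebesgue. gauss x * Y x) = 0 \<Longrightarrow>
      (LINT x|lebesgue. antideriv u0 x * Y x) = 0 \<Longrightarrow>
      energy (- 1 / 2) Y y \<le> K * energy (3 / 2) Y y"
proof -
  let ?v = "antideriv u0"
  obtain D where D: "0 < D"
    "\<And>W w. form_domain W w \<Longrightarrow> integrable lebesgue (\<lambda>x. ?v x * W x)"
    "\<And>W w. form_domain W w \<Longrightarrow>
      (LINT x|lebesgue. ?v x * W x)\<^sup>2 \<le> D * (LINT x|lebesgue. (1 + x\<^sup>2) * (W x)\<^sup>2)"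
    using antideriv_u0_Cauchy_Schwarz by blast
  let ?g1 = "\<lambda>x. x * gauss x" and ?g1' = "\<lambda>x. (1 - x\<^sup>2 / 2) * gauss x"
  define m where "m = (LINT x|lebesgue. ?v x * ?g1 x)"
  have m: "0 < m" unfolding m_def by (rule antideriv_u0_x_gauss)
  define N1 where "N1 = energy (- 1 / 2) ?g1 ?g1'"
  have N1: "0 \<le> N1" unfolding N1_def by (rule energy_norm_nonneg)
  \<comment> \<open>The factors 2 come from \<open>energy_norm_add\<close>,
    \<open>4 * D / m\<^sup>2\<close> from the bound on \<open>\<beta>\<^sup>2\<close>,
    \<open>N1\<close> from the norm of \<open>x gauss\<close>, and 21 from the bound on
    \<open>W2\<close>.\<close>
  define K where "K = (2 + 2 * (4 * D / m\<^sup>2) * N1) * 21"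
  have "0 \<le> 4 * D / m\<^sup>2 * N1" using D(1) N1 by (intro mult_nonneg_nonneg) auto
  then have K: "1 < K" by (simp add: K_def)
  define G where "G = (LINT x|lebesgue. (gauss x)\<^sup>2)"
  have G: "0 < G" unfolding G_def by (rule integral_gauss_square_pos)
  have "energy (- 1 / 2) Y y \<le> K * energy (3 / 2) Y y"
    if Y: "form_domain Y y" and orth: "(LINT x|lebesgue. gauss x * Y x) = 0" and orth': "(LINT x|lebesgue. ?v x * Y x) = 0"
    for Y y
  proof -
    let ?F = "energy (3 / 2) Y y"
    \<comment> \<open>any \<open>a\<close> with \<open>1 < a\<^sup>2 < 5 / 4\<close>; \<open>\<alpha>\<close> and \<open>\<beta>\<close> are chosen to make \<open>W\<close> vanish at \<open>\<plusminus> a\<close>\<close>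
    define a :: real where "a = 21 / 20"
    have a: "1 < a" "a\<^sup>2 < 5 / 4" "a \<noteq> 0" by (simp_all add: a_def power2_eq_square)
    define \<alpha> where "\<alpha> = - (Y a + Y (- a)) / (2 * gauss a)"
    define \<beta> where "\<beta> = - (Y a - Y (- a)) / (2 * a * gauss a)"
    define W2 where "W2 x = Y x + \<beta> * ?g1 x" for x
    define w2 where "w2 x = y x + \<beta> * ?g1' x" for x
    define W where "W x = Y x + (\<alpha> * gauss x + \<beta> * ?g1 x)" for x
    define w where "w x = y x + (\<alpha> * (- (x / 2) * gauss x) + \<beta> * ?g1' x)" for x
    have fW2: "form_domain W2 w2"
      unfolding W2_def[abs_def] w2_def[abs_def] by (intro form_domain_add form_domain_cmult Y form_domain_x_gauss)
    have fW: "form_domain W w"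
      unfolding W_def[abs_def] w_def[abs_def] by (intro form_domain_add form_domain_cmult Y form_domain_gauss form_domain_x_gauss)
    have ga: "gauss (- a) = gauss a" "gauss a \<noteq> 0"
      using gauss_pos[of a] by (auto simp: gauss_def)
    have "W a = 0" "W (- a) = 0"
      unfolding W_def[abs_def] \<alpha>_def \<beta>_def ga(1) using ga(2) a(3) by (simp_all add: field_simps)
    then have gap: "1 / 10 * (LINT x|lebesgue. (W x)\<^sup>2) \<le> energy (3 / 2) W w"
      unfolding energy_def by (rule energy_gap_of_zeros[OF fW a(1,2)])
    have EW: "energy (3 / 2) W w = ?F - \<alpha>\<^sup>2 * G"
      unfolding W_def[abs_def] w_def[abs_def] G_def by (rule energy_perturb[OF Y orth])
    have EW2: "energy (3 / 2) W2 w2 = ?F"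
      using energy_perturb[OF Y orth, of 0 \<beta>] by (simp add: W2_def[abs_def] w2_def[abs_def])
    have orth2: "(LINT x|lebesgue. gauss x * W2 x) = 0"
    proof -
      have "(LINT x|lebesgue. gauss x * W2 x) = (LINT x|lebesgue. gauss x * Y x + \<beta> * (gauss x * ?g1 x))"
        by (intro Bochner_Integration.integral_cong) (auto simp: W2_def[abs_def] algebra_simps)
      then show ?thesis
        using form_domain_mult_integrable(1)[OF form_domain_gauss Y] orth integral_x_gauss_square
          form_domain_mult_integrable(1)[OF form_domain_gauss form_domain_x_gauss] by simp
    qed
    have "(LINT x|lebesgue. (W x)\<^sup>2) = (LINT x|lebesgue. (W2 x)\<^sup>2 + (2 * \<alpha> * (gauss x * W2 x) + \<alpha>\<^sup>2 * (gauss x)\<^sup>2))"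
      by (intro Bochner_Integration.integral_cong) (auto simp: W_def[abs_def] W2_def[abs_def] algebra_simps power2_eq_square)
    also have "\<dots> = (LINT x|lebesgue. (W2 x)\<^sup>2) + \<alpha>\<^sup>2 * G"
      using form_domainD(6)[OF fW2] form_domain_mult_integrable(1)[OF form_domain_gauss fW2] orth2
        form_domainD(6)[OF form_domain_gauss] by (simp add: G_def)
    finally have PW: "(LINT x|lebesgue. (W x)\<^sup>2) = (LINT x|lebesgue. (W2 x)\<^sup>2) + \<alpha>\<^sup>2 * G" .
    \<comment> \<open>The gap reads \<open>(P + \<alpha>^2 G) / 10 \<le> F - \<alpha>^2 G\<close>,
      where \<open>P\<close> is the squared \<open>L2\<close> norm of \<open>W2\<close> and
      \<open>F\<close> the energy of \<open>Y\<close>; both terms in \<open>\<alpha>\<close> have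
      the sign that allows dropping them.\<close>
    have "0 \<le> \<alpha>\<^sup>2 * G" using G by simp
    then have "(LINT x|lebesgue. (W2 x)\<^sup>2) \<le> 10 * ?F"
      using gap unfolding EW PW distrib_left by linarith
    \<comment> \<open>Passing from 3/2 to -1/2 adds twice the squared \<open>L2\<close> norm, and
      \<open>1 + 2 * 10 = 21\<close>.\<close>
    then have N2: "energy (- 1 / 2) W2 w2 \<le> 21 * ?F"
      using energy_shift[OF fW2, of "- 1 / 2" "3 / 2"] EW2 by simp
    \<comment> \<open>Pairing with the constraint function kills the part \<open>Y\<close> of
      \<open>W2\<close> and isolates \<open>\<beta>\<close>.\<close>
    have "(LINT x|lebesgue. ?v x * W2 x) = (LINT x|lebesgue. ?v x * Y x + \<beta> * (?v x * ?g1 x))"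
      by (intro Bochner_Integration.integral_cong) (auto simp: W2_def[abs_def] algebra_simps)
    also have "\<dots> = \<beta> * m"
      using D(2)[OF Y] D(2)[OF form_domain_x_gauss] orth' by (simp add: m_def)
    finally have "(\<beta> * m)\<^sup>2 \<le> D * (LINT x|lebesgue. (1 + x\<^sup>2) * (W2 x)\<^sup>2)"
      using D(3)[OF fW2] by simp
    also have "\<dots> \<le> D * (4 * energy (- 1 / 2) W2 w2)"
      using D(1) by (intro mult_left_mono weight_le_energy_norm[OF fW2]) simp
    finally have "(\<beta> * m)\<^sup>2 \<le> D * (4 * energy (- 1 / 2) W2 w2)" .
    then have \<beta>: "\<beta>\<^sup>2 \<le> (4 * D / m\<^sup>2) * energy (- 1 / 2) W2 w2"
      using m by (simp add: power_mult_distrib field_simps)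
    have "energy (- 1 / 2) Y y = energy (- 1 / 2) (\<lambda>x. W2 x + (- \<beta>) * ?g1 x) (\<lambda>x. w2 x + (- \<beta>) * ?g1' x)"
      by (simp add: W2_def[abs_def] w2_def[abs_def])
    also have "\<dots> \<le> 2 * energy (- 1 / 2) W2 w2 + 2 * energy (- 1 / 2) (\<lambda>x. (- \<beta>) * ?g1 x) (\<lambda>x. (- \<beta>) * ?g1' x)"
      by (intro energy_norm_add fW2 form_domain_cmult form_domain_x_gauss)
    also have "\<dots> = 2 * energy (- 1 / 2) W2 w2 + 2 * (\<beta>\<^sup>2 * N1)"
      unfolding energy_cmult N1_def by simp
    also have "\<dots> \<le> 2 * energy (- 1 / 2) W2 w2 + 2 * ((4 * D / m\<^sup>2) * energy (- 1 / 2) W2 w2 * N1)"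
      using mult_right_mono[OF \<beta> N1] by simp
    also have "\<dots> = (2 + 2 * (4 * D / m\<^sup>2) * N1) * energy (- 1 / 2) W2 w2"
      by (simp add: algebra_simps)
    also have "\<dots> \<le> (2 + 2 * (4 * D / m\<^sup>2) * N1) * (21 * ?F)"
      by (intro mult_left_mono N2 add_nonneg_nonneg mult_nonneg_nonneg) (use D(1) N1 in auto)
    finally show ?thesis by (simp only: K_def mult.assoc)
  qed
  with K show ?thesis by (rule that)
qed

section \<open>Transfer from continuous representatives to Sobolev functions\<close>

theorem theorem3p1:
  "\<exists>C::real. 0 < C \<and> C < 1 \<and>
     (\<forall>y \<in> H1 \<inter> L2_1.
        L2_inner u0 y = 0 \<and> L2_inner (antideriv u0) y = 0 \<longrightarrow>
        C * (H1_L2_1_norm y)\<^sup>2 \<le> E_c y \<and> E_c y \<le> (H1_L2_1_norm y)\<^sup>2)"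
proof -
  obtain K where K: "1 < K"
    "\<And>Y y. form_domain Y y \<Longrightarrow> (LINT x|lebesgue. gauss x * Y x) = 0 \<Longrightarrow>
      (LINT x|lebesgue. antideriv u0 x * Y x) = 0 \<Longrightarrow>
      energy (- 1 / 2) Y y \<le> K * energy (3 / 2) Y y"
    using energy_coercive by blast
  have "1 / K * (H1_L2_1_norm y)\<^sup>2 \<le> E_c y \<and> E_c y \<le> (H1_L2_1_norm y)\<^sup>2"
    if y: "y \<in> H1 \<inter> L2_1" and orth: "L2_inner u0 y = 0" "L2_inner (antideriv u0) y = 0" for y
  proof -
    let ?g = "weak_deriv y"
    have "\<exists>g. g \<in> L2 \<and> has_weak_deriv y g" using y by (auto simp: H1_def)
    then have g: "?g \<in> L2 \<and> has_weak_deriv y ?g"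
      unfolding weak_deriv_def by (rule someI_ex)
    have yL: "y \<in> L2" using y by (simp add: H1_def)
    \<comment> \<open>\<open>Y\<close> keeps the chosen weak derivative itself and differs from
      \<open>y\<close> only on a null set, so the constraints, the form and the norm can all be
      computed from \<open>Y\<close>.\<close>
    obtain Y where Y: "primitive_on UNIV Y ?g" and ae: "AE x in lebesgue. y x = Y x"
      using weak_deriv_primitive[OF yL] g by blast
    have my: "y \<in> borel_measurable lebesgue" and wy: "integrable lebesgue (\<lambda>x. (1 + x\<^sup>2) * (y x)\<^sup>2)"
      using y by (auto simp: L2_1_def)
    have mg: "?g \<in> borel_measurable lebesgue" and ig: "integrable lebesgue (\<lambda>x. (?g x)\<^sup>2)"
      using g by (auto simp: L2_def)
    have mY: "Y \<in> borel_measurable lebesgue"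
      by (intro borel_measurable_lebesgueI borel_measurable_continuous_onI primitive_on_UNIV_continuous[OF Y])
    have mx: "(\<lambda>x::real. x) \<in> borel_measurable lebesgue" by (intro borel_measurable_lebesgueI) simp
    note [measurable] = my mg mY mx
    have "integrable lebesgue (\<lambda>x. (1 + x\<^sup>2) * (Y x)\<^sup>2)"
      by (rule integrable_cong_AE_imp[OF wy]) (measurable, use ae in \<open>auto elim!: eventually_mono\<close>)
    then have fY: "form_domain Y ?g"
      using Y mg ig by (simp add: form_domain_def)
    have cong: "(LINT x|lebesgue. f x * y x) = (LINT x|lebesgue. f x * Y x)"
      if [measurable]: "f \<in> borel_measurable lebesgue" for f
      by (rule integral_cong_AE) (measurable, use ae in \<open>auto elim!: eventually_mono\<close>)
    have "(LINT x|lebesgue. gauss x * y x) = 0"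
      using orth(1) by (simp add: L2_inner_def u0_eq mult.assoc)
    then have 1: "(LINT x|lebesgue. gauss x * Y x) = 0"
      by (subst (asm) cong) (auto intro!: borel_measurable_lebesgueI borel_measurable_continuous_onI continuous_on_gauss)
    have "(LINT x|lebesgue. antideriv u0 x * y x) = 0"
      using orth(2) by (simp add: L2_inner_def)
    then have 2: "(LINT x|lebesgue. antideriv u0 x * Y x) = 0"
      by (subst (asm) cong) (auto intro!: borel_measurable_lebesgueI borel_measurable_continuous_onI
          primitive_on_UNIV_continuous[OF antideriv_u0_primitive])
    have E: "E_c y = energy (3 / 2) Y ?g"
      unfolding E_c_def energy_def
      by (rule integral_cong_AE) (measurable, use ae in \<open>auto elim!: eventually_mono simp: algebra_simps\<close>)
    have N: "(H1_L2_1_norm y)\<^sup>2 = energy (- 1 / 2) Y ?g"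
    proof -
      have "(H1_L2_1_norm y)\<^sup>2 = (LINT x|lebesgue. (?g x)\<^sup>2 + 1/4 * x\<^sup>2 * (y x)\<^sup>2 + 1/2 * (y x)\<^sup>2)"
        unfolding H1_L2_1_norm_def by (intro real_sqrt_pow2 integral_nonneg_AE AE_I2) simp
      also have "\<dots> = energy (- 1 / 2) Y ?g"
        unfolding energy_def
        by (rule integral_cong_AE) (measurable, use ae in \<open>auto elim!: eventually_mono simp: algebra_simps\<close>)
      finally show ?thesis .
    qed
    have nn: "0 \<le> (LINT x|lebesgue. (Y x)\<^sup>2)" by simp
    \<comment> \<open>The upper bound: the form and the squared norm differ by twice the squared
      \<open>L2\<close> norm.\<close>
    have "energy (3 / 2) Y ?g \<le> energy (- 1 / 2) Y ?g"
      using energy_shift[OF fY, of "- 1 / 2" "3 / 2"] nn by simp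
    then show ?thesis
      using K(2)[OF fY 1 2] K(1) unfolding E N by (simp add: field_simps)
  qed
  then show ?thesis
    using K(1) by (intro exI[of _ "1 / K"]) auto
qed

end
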